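(* If an $L$ clause set $R(x)$ is refuted by an $L$ clause set cycle, then $I\exists_1\vdash\neg R(x)$ (i.e. the universal closure of $\neg R(x)$ is derivable from $I\exists_1$ over $L$).
   Context: We work in many-sorted classical first-order logic over a language $L$ with finitely many sorts, among them a sort $\mathsf{nat}$, and containing function symbols $0:\mathsf{nat}$ and $s:\mathsf{nat}\to\mathsf{nat}$. For $k\in\mathbb{N}$, $\overline{k}=s^k0$. A literal is an atom or negated atom; an $L$ clause is a formula $\forall\vec y\,(l_1\vee\dots\vee l_k)$ with literals $l_i$; an $L$ clause set is a finite conjunction of $L$ clauses; clause sets are written $R(x)$, $S(x)$ with only free variable $x$ of sort $\mathsf{nat}$. $\varphi\models\psi$ means every structure and variable assignment satisfying $\varphi$ satisfies $\psi$. An $L$ clause set $S(x)$ is an $L$ clause set cycle if $S(sx)\models S(x)$ and $S(0)\models\bot$. An $L$ clause set $R(x)$ is refuted by the clause set cycle $S(x)$ if there is $n\in\mathbb{N}$ with $R(s^nx)\models S(x)$ and $R(\overline{k})\models\bot$ for all $k\in\{0,\dots,n-1\}$. For a formula $\psi(x,\vec z)$ with $x$ of sort $\mathsf{nat}$, $I_x\psi := \forall\vec z\,(\psi(0,\vec z)\to\forall x\,(\psi(x,\vec z)\to\psi(sx,\vec z))\to\forall x\,\psi(x,\vec z))$. The theory $I\exists_1$ is the set of all $I_x\psi$ with $\psi$ an $L$ formula of the form $\exists\vec y\,\varphi$, $\varphi$ quantifier-free, and $x$ of sort $\mathsf{nat}$. *)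

theory Defs
  imports Main
begin

text \<open>
  Many-sorted classical first-order logic with equality.  The sorts are the elements of a
  type \<open>'s\<close>, which the results instantiate to a finite type.  The function and predicate
  symbols are sets, so that a language may have no predicate symbols at all.
\<close>

record ('s, 'f, 'p) language =
  funs :: "'f set"
  preds :: "'p set"
  fdom :: "'f \<Rightarrow> 's list"
  fcod :: "'f \<Rightarrow> 's"
  pdom :: "'p \<Rightarrow> 's list"
  nat_sort :: 's
  zero_sym :: 'f
  succ_sym :: 'f

definition is_language :: "('s, 'f, 'p) language \<Rightarrow> bool" where
  "is_language L \<longleftrightarrow>
     zero_sym L \<in> funs L \<and> fdom L (zero_sym L) = [] \<and> fcod L (zero_sym L) = nat_sort L \<and>
     succ_sym L \<in> funs L \<and> fdom L (succ_sym L) = [nat_sort L] \<and> fcod L (succ_sym L) = nat_sort L"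

text \<open>The second component of a variable is its sort; every sort has infinitely many variables.\<close>

type_synonym 's var = "nat \<times> 's"

datatype ('s, 'f) tm = Var "'s var" | Fun 'f "('s, 'f) tm list"

datatype ('s, 'f, 'p) fm =
    Bot
  | Eq "('s, 'f) tm" "('s, 'f) tm"
  | Pred 'p "('s, 'f) tm list"
  | Imp "('s, 'f, 'p) fm" "('s, 'f, 'p) fm"
  | Forall "'s var" "('s, 'f, 'p) fm"

definition Neg :: "('s, 'f, 'p) fm \<Rightarrow> ('s, 'f, 'p) fm" where
  "Neg \<phi> = Imp \<phi> Bot"

definition Top :: "('s, 'f, 'p) fm" where
  "Top = Neg Bot"

definition Or :: "('s, 'f, 'p) fm \<Rightarrow> ('s, 'f, 'p) fm \<Rightarrow> ('s, 'f, 'p) fm" where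
  "Or \<phi> \<psi> = Imp (Neg \<phi>) \<psi>"

definition And :: "('s, 'f, 'p) fm \<Rightarrow> ('s, 'f, 'p) fm \<Rightarrow> ('s, 'f, 'p) fm" where
  "And \<phi> \<psi> = Neg (Imp \<phi> (Neg \<psi>))"

definition Exists :: "'s var \<Rightarrow> ('s, 'f, 'p) fm \<Rightarrow> ('s, 'f, 'p) fm" where
  "Exists x \<phi> = Neg (Forall x (Neg \<phi>))"

fun Disj :: "('s, 'f, 'p) fm list \<Rightarrow> ('s, 'f, 'p) fm" where
  "Disj [] = Bot"
| "Disj [\<phi>] = \<phi>"
| "Disj (\<phi> # \<psi> # \<phi>s) = Or \<phi> (Disj (\<psi> # \<phi>s))"

fun Conj :: "('s, 'f, 'p) fm list \<Rightarrow> ('s, 'f, 'p) fm" where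
  "Conj [] = Top"
| "Conj [\<phi>] = \<phi>"
| "Conj (\<phi> # \<psi> # \<phi>s) = And \<phi> (Conj (\<psi> # \<phi>s))"

definition Forall_list :: "'s var list \<Rightarrow> ('s, 'f, 'p) fm \<Rightarrow> ('s, 'f, 'p) fm" where
  "Forall_list xs \<phi> = foldr Forall xs \<phi>"

definition Exists_list :: "'s var list \<Rightarrow> ('s, 'f, 'p) fm \<Rightarrow> ('s, 'f, 'p) fm" where
  "Exists_list xs \<phi> = foldr Exists xs \<phi>"

fun has_sort :: "('s, 'f, 'p) language \<Rightarrow> ('s, 'f) tm \<Rightarrow> 's \<Rightarrow> bool" where
  "has_sort L (Var x) \<sigma> \<longleftrightarrow> snd x = \<sigma>"
| "has_sort L (Fun f ts) \<sigma> \<longleftrightarrow> f \<in> funs L \<and> fcod L f = \<sigma> \<and> list_all2 (has_sort L) ts (fdom L f)"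

primrec is_formula :: "('s, 'f, 'p) language \<Rightarrow> ('s, 'f, 'p) fm \<Rightarrow> bool" where
  "is_formula L Bot \<longleftrightarrow> True"
| "is_formula L (Eq t u) \<longleftrightarrow> (\<exists>\<sigma>. has_sort L t \<sigma> \<and> has_sort L u \<sigma>)"
| "is_formula L (Pred p ts) \<longleftrightarrow> p \<in> preds L \<and> list_all2 (has_sort L) ts (pdom L p)"
| "is_formula L (Imp \<phi> \<psi>) \<longleftrightarrow> is_formula L \<phi> \<and> is_formula L \<psi>"
| "is_formula L (Forall x \<phi>) \<longleftrightarrow> is_formula L \<phi>"

fun tvars :: "('s, 'f) tm \<Rightarrow> 's var set" where
  "tvars (Var x) = {x}"
| "tvars (Fun f ts) = (\<Union>t\<in>set ts. tvars t)"

primrec fvars :: "('s, 'f, 'p) fm \<Rightarrow> 's var set" where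
  "fvars Bot = {}"
| "fvars (Eq t u) = tvars t \<union> tvars u"
| "fvars (Pred p ts) = (\<Union>t\<in>set ts. tvars t)"
| "fvars (Imp \<phi> \<psi>) = fvars \<phi> \<union> fvars \<psi>"
| "fvars (Forall x \<phi>) = fvars \<phi> - {x}"

primrec quantifier_free :: "('s, 'f, 'p) fm \<Rightarrow> bool" where
  "quantifier_free Bot \<longleftrightarrow> True"
| "quantifier_free (Eq t u) \<longleftrightarrow> True"
| "quantifier_free (Pred p ts) \<longleftrightarrow> True"
| "quantifier_free (Imp \<phi> \<psi>) \<longleftrightarrow> quantifier_free \<phi> \<and> quantifier_free \<psi>"
| "quantifier_free (Forall x \<phi>) \<longleftrightarrow> False"

text \<open>
  Capture-avoiding simultaneous substitution.  A bound variable is renamed, within its sort,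
  only if it would otherwise capture a variable of a substituted term.
\<close>

fun tsubst :: "('s var \<Rightarrow> ('s, 'f) tm) \<Rightarrow> ('s, 'f) tm \<Rightarrow> ('s, 'f) tm" where
  "tsubst \<theta> (Var x) = \<theta> x"
| "tsubst \<theta> (Fun f ts) = Fun f (map (tsubst \<theta>) ts)"

definition variant :: "'s var \<Rightarrow> 's var set \<Rightarrow> 's var" where
  "variant x V = (if x \<in> V then (LEAST n. (n, snd x) \<notin> V, snd x) else x)"

primrec fsubst :: "('s var \<Rightarrow> ('s, 'f) tm) \<Rightarrow> ('s, 'f, 'p) fm \<Rightarrow> ('s, 'f, 'p) fm" where
  "fsubst \<theta> Bot = Bot"
| "fsubst \<theta> (Eq t u) = Eq (tsubst \<theta> t) (tsubst \<theta> u)"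
| "fsubst \<theta> (Pred p ts) = Pred p (map (tsubst \<theta>) ts)"
| "fsubst \<theta> (Imp \<phi> \<psi>) = Imp (fsubst \<theta> \<phi>) (fsubst \<theta> \<psi>)"
| "fsubst \<theta> (Forall x \<phi>) =
     (let x' = variant x (\<Union>y\<in>fvars \<phi> - {x}. tvars (\<theta> y))
      in Forall x' (fsubst (\<theta>(x := Var x')) \<phi>))"

definition inst :: "('s, 'f, 'p) fm \<Rightarrow> 's var \<Rightarrow> ('s, 'f) tm \<Rightarrow> ('s, 'f, 'p) fm" where
  "inst \<phi> x t = fsubst (Var(x := t)) \<phi>"

text \<open>
  The carriers of a structure are nonempty, not necessarily disjoint subsets of a common
  type \<open>'u\<close>.
\<close>

record ('u, 's, 'f, 'p) fo_structure =
  univ :: "'s \<Rightarrow> 'u set"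
  finterp :: "'f \<Rightarrow> 'u list \<Rightarrow> 'u"
  pinterp :: "'p \<Rightarrow> 'u list \<Rightarrow> bool"

definition is_structure :: "('s, 'f, 'p) language \<Rightarrow> ('u, 's, 'f, 'p) fo_structure \<Rightarrow> bool" where
  "is_structure L M \<longleftrightarrow>
     (\<forall>\<sigma>. univ M \<sigma> \<noteq> {}) \<and>
     (\<forall>f\<in>funs L. \<forall>as. list_all2 (\<lambda>a \<sigma>. a \<in> univ M \<sigma>) as (fdom L f) \<longrightarrow>
        finterp M f as \<in> univ M (fcod L f))"

definition is_assignment :: "('u, 's, 'f, 'p) fo_structure \<Rightarrow> ('s var \<Rightarrow> 'u) \<Rightarrow> bool" where
  "is_assignment M e \<longleftrightarrow> (\<forall>x. e x \<in> univ M (snd x))"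

fun teval :: "('u, 's, 'f, 'p) fo_structure \<Rightarrow> ('s var \<Rightarrow> 'u) \<Rightarrow> ('s, 'f) tm \<Rightarrow> 'u" where
  "teval M e (Var x) = e x"
| "teval M e (Fun f ts) = finterp M f (map (teval M e) ts)"

primrec sat :: "('u, 's, 'f, 'p) fo_structure \<Rightarrow> ('s var \<Rightarrow> 'u) \<Rightarrow> ('s, 'f, 'p) fm \<Rightarrow> bool" where
  "sat M e Bot \<longleftrightarrow> False"
| "sat M e (Eq t u) \<longleftrightarrow> teval M e t = teval M e u"
| "sat M e (Pred p ts) \<longleftrightarrow> pinterp M p (map (teval M e) ts)"
| "sat M e (Imp \<phi> \<psi>) \<longleftrightarrow> (sat M e \<phi> \<longrightarrow> sat M e \<psi>)"
| "sat M e (Forall x \<phi>) \<longleftrightarrow> (\<forall>a\<in>univ M (snd x). sat M (e(x := a)) \<phi>)"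

text \<open>
  A HOL formula cannot quantify over all types, so entailment takes the type \<open>'u\<close> of possible
  elements as a parameter.  Since the carriers are arbitrary nonempty subsets of \<open>'u\<close> and a
  formula has only finitely many symbols, the downward Loewenheim-Skolem theorem shows that for
  every infinite \<open>'u\<close> this is entailment over all structures.
\<close>

definition entails ::
  "'u itself \<Rightarrow> ('s, 'f, 'p) language \<Rightarrow> ('s, 'f, 'p) fm \<Rightarrow> ('s, 'f, 'p) fm \<Rightarrow> bool" where
  "entails U L \<phi> \<psi> \<longleftrightarrow>
     (\<forall>(M :: ('u, 's, 'f, 'p) fo_structure) e.
        is_structure L M \<longrightarrow> is_assignment M e \<longrightarrow> sat M e \<phi> \<longrightarrow> sat M e \<psi>)"

text \<open>Classical natural deduction for formulas over \<open>L\<close>, with \<open>\<Gamma>\<close> the set of open assumptions.\<close>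

inductive derivable ::
  "('s, 'f, 'p) language \<Rightarrow> ('s, 'f, 'p) fm set \<Rightarrow> ('s, 'f, 'p) fm \<Rightarrow> bool" for L where
  Assm: "\<phi> \<in> \<Gamma> \<Longrightarrow> is_formula L \<phi> \<Longrightarrow> derivable L \<Gamma> \<phi>"
| ImpI: "is_formula L \<phi> \<Longrightarrow> derivable L (insert \<phi> \<Gamma>) \<psi> \<Longrightarrow> derivable L \<Gamma> (Imp \<phi> \<psi>)"
| ImpE: "derivable L \<Gamma> (Imp \<phi> \<psi>) \<Longrightarrow> derivable L \<Gamma> \<phi> \<Longrightarrow> derivable L \<Gamma> \<psi>"
| Raa: "is_formula L \<phi> \<Longrightarrow> derivable L (insert (Neg \<phi>) \<Gamma>) Bot \<Longrightarrow> derivable L \<Gamma> \<phi>"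
| AllI: "is_formula L (Forall x \<phi>) \<Longrightarrow> snd y = snd x \<Longrightarrow> y \<notin> fvars (Forall x \<phi>) \<Longrightarrow>
    (\<forall>\<gamma>\<in>\<Gamma>. y \<notin> fvars \<gamma>) \<Longrightarrow> derivable L \<Gamma> (inst \<phi> x (Var y)) \<Longrightarrow> derivable L \<Gamma> (Forall x \<phi>)"
| AllE: "derivable L \<Gamma> (Forall x \<phi>) \<Longrightarrow> has_sort L t (snd x) \<Longrightarrow> derivable L \<Gamma> (inst \<phi> x t)"
| EqI: "has_sort L t \<sigma> \<Longrightarrow> derivable L \<Gamma> (Eq t t)"
| EqE: "is_formula L \<phi> \<Longrightarrow> has_sort L t (snd x) \<Longrightarrow> has_sort L u (snd x) \<Longrightarrow>
    derivable L \<Gamma> (Eq t u) \<Longrightarrow> derivable L \<Gamma> (inst \<phi> x t) \<Longrightarrow> derivable L \<Gamma> (inst \<phi> x u)"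

definition Zero :: "('s, 'f, 'p) language \<Rightarrow> ('s, 'f) tm" where
  "Zero L = Fun (zero_sym L) []"

definition Succ :: "('s, 'f, 'p) language \<Rightarrow> ('s, 'f) tm \<Rightarrow> ('s, 'f) tm" where
  "Succ L t = Fun (succ_sym L) [t]"

definition Succs :: "('s, 'f, 'p) language \<Rightarrow> nat \<Rightarrow> ('s, 'f) tm \<Rightarrow> ('s, 'f) tm" where
  "Succs L n t = (Succ L ^^ n) t"

definition numeral_tm :: "('s, 'f, 'p) language \<Rightarrow> nat \<Rightarrow> ('s, 'f) tm" where
  "numeral_tm L k = Succs L k (Zero L)"

definition is_atom :: "('s, 'f, 'p) fm \<Rightarrow> bool" where
  "is_atom \<phi> \<longleftrightarrow> (\<exists>t u. \<phi> = Eq t u) \<or> (\<exists>p ts. \<phi> = Pred p ts)"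

definition is_literal :: "('s, 'f, 'p) fm \<Rightarrow> bool" where
  "is_literal \<phi> \<longleftrightarrow> is_atom \<phi> \<or> (\<exists>\<alpha>. is_atom \<alpha> \<and> \<phi> = Neg \<alpha>)"

definition is_clause :: "('s, 'f, 'p) language \<Rightarrow> ('s, 'f, 'p) fm \<Rightarrow> bool" where
  "is_clause L \<phi> \<longleftrightarrow> is_formula L \<phi> \<and>
     (\<exists>ys ls. \<phi> = Forall_list ys (Disj ls) \<and> (\<forall>l\<in>set ls. is_literal l))"

definition is_clause_set :: "('s, 'f, 'p) language \<Rightarrow> ('s, 'f, 'p) fm \<Rightarrow> bool" where
  "is_clause_set L \<phi> \<longleftrightarrow> (\<exists>cs. \<phi> = Conj cs \<and> (\<forall>c\<in>set cs. is_clause L c))"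

text \<open>Clause sets \<open>S(x)\<close> with at most \<open>x\<close> free, where \<open>x\<close> has sort \<open>nat\<close>.\<close>

definition is_clause_set_in ::
  "('s, 'f, 'p) language \<Rightarrow> 's var \<Rightarrow> ('s, 'f, 'p) fm \<Rightarrow> bool" where
  "is_clause_set_in L x S \<longleftrightarrow> snd x = nat_sort L \<and> is_clause_set L S \<and> fvars S \<subseteq> {x}"

definition clause_set_cycle ::
  "'u itself \<Rightarrow> ('s, 'f, 'p) language \<Rightarrow> 's var \<Rightarrow> ('s, 'f, 'p) fm \<Rightarrow> bool" where
  "clause_set_cycle U L x S \<longleftrightarrow> is_clause_set_in L x S \<and>
     entails U L (inst S x (Succ L (Var x))) S \<and>
     entails U L (inst S x (Zero L)) Bot"

definition refuted_by ::
  "'u itself \<Rightarrow> ('s, 'f, 'p) language \<Rightarrow> 's var \<Rightarrow> ('s, 'f, 'p) fm \<Rightarrow> ('s, 'f, 'p) fm \<Rightarrow> bool" where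
  "refuted_by U L x R S \<longleftrightarrow>
     (\<exists>n. entails U L (inst R x (Succs L n (Var x))) S \<and>
          (\<forall>k<n. entails U L (inst R x (numeral_tm L k)) Bot))"

definition induction_fm ::
  "('s, 'f, 'p) language \<Rightarrow> 's var list \<Rightarrow> 's var \<Rightarrow> ('s, 'f, 'p) fm \<Rightarrow> ('s, 'f, 'p) fm" where
  "induction_fm L zs x \<psi> =
     Forall_list zs (Imp (inst \<psi> x (Zero L))
             (Imp (Forall x (Imp \<psi> (inst \<psi> x (Succ L (Var x)))))
                  (Forall x \<psi>)))"

text \<open>The parameters \<open>zs\<close> may be listed in any order.\<close>

definition IE1 :: "('s, 'f, 'p) language \<Rightarrow> ('s, 'f, 'p) fm set" where
  "IE1 L = {induction_fm L zs x \<psi> | zs x \<psi>.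
     is_formula L \<psi> \<and> (\<exists>ys \<phi>. \<psi> = Exists_list ys \<phi> \<and> quantifier_free \<phi>) \<and>
     snd x = nat_sort L \<and> distinct zs \<and> set zs = fvars \<psi> - {x}}"

end

theory Submission
  imports Defs "HOL-Library.Countable_Set"
begin

text \<open>
  By completeness, it suffices to derive \<open>\<forall>x. \<not> R(x)\<close> semantically from two instances of existential
  induction.  The negated clause set \<open>\<not> S(x)\<close> is equivalent to an existential formula, and the
  clause set cycle provides base case and step of its induction, so \<open>S\<close> has no element.  Induction
  on \<open>x = 0 \<or> (\<exists>y. x = s y)\<close> shows that every element is some \<open>k < n\<close> or of the form \<open>s\<^sup>n y\<close>,
  even in nonstandard models; in both cases \<open>R\<close> fails.
  The Henkin construction works inside the given infinite type \<open>'u\<close>, since a single formula has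
  finitely many symbols and hence a countable term model.
\<close>

section \<open>Substitution up to renaming of bound variables\<close>

text \<open>The hypotheses are entailments between formulas, while the conclusion asserts
  derivability. They meet in one sentence, an implication with the two induction instances as
  premises and the claim as conclusion. Hence completeness is needed only for a single formula
  without assumptions, and no infinite theory has to be modelled. Passing to the negation of
  \<open>S\<close> serves two ends: it turns universal clauses into an existential formula, and
  contraposition turns a condition that leads from the successor down to \<open>x\<close> into an
  inductive step that leads upwards. The second instance is needed because emptiness of
  \<open>S\<close> refutes \<open>R\<close> only at elements with \<open>n\<close> predecessors. The
  technical obstacle is renaming: \<open>fsubst\<close> computes bound names from its input, so two
  successive substitutions may yield other bound names than a single one. The quantifier case of the
  truth lemma composes substitutions in just this way.\<close>

text \<open>
  \<open>subst_rel \<theta> \<phi> \<psi>\<close> says that \<open>\<psi>\<close> is \<open>\<phi>\<theta>\<close> for some admissible choice of bound variables.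
  Unlike \<^const>\<open>fsubst\<close>, this relation is closed under composition of substitutions.
\<close>

primrec subst_rel ::
  "('s var \<Rightarrow> ('s, 'f) tm) \<Rightarrow> ('s, 'f, 'p) fm \<Rightarrow> ('s, 'f, 'p) fm \<Rightarrow> bool" where
  "subst_rel \<theta> Bot \<psi> \<longleftrightarrow> \<psi> = Bot"
| "subst_rel \<theta> (Eq t u) \<psi> \<longleftrightarrow> \<psi> = Eq (tsubst \<theta> t) (tsubst \<theta> u)"
| "subst_rel \<theta> (Pred p ts) \<psi> \<longleftrightarrow> \<psi> = Pred p (map (tsubst \<theta>) ts)"
| "subst_rel \<theta> (Imp \<phi>1 \<phi>2) \<psi> \<longleftrightarrow>
     (\<exists>\<psi>1 \<psi>2. \<psi> = Imp \<psi>1 \<psi>2 \<and> subst_rel \<theta> \<phi>1 \<psi>1 \<and> subst_rel \<theta> \<phi>2 \<psi>2)"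
| "subst_rel \<theta> (Forall x \<phi>) \<psi> \<longleftrightarrow>
     (\<exists>y \<chi>. \<psi> = Forall y \<chi> \<and> snd y = snd x \<and> (\<forall>z\<in>fvars \<phi> - {x}. y \<notin> tvars (\<theta> z)) \<and>
        subst_rel (\<theta>(x := Var y)) \<phi> \<chi>)"

lemma finite_tvars [simp]: "finite (tvars t)"
  by (induction t) auto

lemma finite_fvars [simp]: "finite (fvars \<phi>)"
  by (induction \<phi>) auto

lemma fresh_var:
  fixes V :: "'s var set"
  assumes "finite V"
  obtains y where "snd y = \<sigma>" "y \<notin> V"
proof -
  have "infinite (range (\<lambda>n::nat. (n, \<sigma>)))"
    by (auto intro!: range_inj_infinite injI)
  then obtain y where "y \<in> range (\<lambda>n::nat. (n, \<sigma>))" "y \<notin> V"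
    using assms by (meson finite_subset subsetI)
  then show thesis by (intro that[of y]) auto
qed

lemma snd_variant [simp]: "snd (variant x V) = snd x"
  by (simp add: variant_def)

lemma variant_fresh:
  assumes "finite V"
  shows "variant x V \<notin> V"
proof -
  obtain y where "snd y = snd x" "y \<notin> V"
    by (rule fresh_var[OF assms])
  then have "\<exists>n. (n, snd x) \<notin> V"
    by (metis prod.collapse)
  then show ?thesis
    using LeastI_ex[of "\<lambda>n. (n, snd x) \<notin> V"] by (auto simp: variant_def)
qed

lemma tsubst_cong: "(\<And>x. x \<in> tvars t \<Longrightarrow> \<theta> x = \<theta>' x) \<Longrightarrow> tsubst \<theta> t = tsubst \<theta>' t"
  by (induction t) auto

lemma tsubst_Var [simp]: "tsubst Var t = t"
  by (induction t) (auto simp: map_idI)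

lemma tsubst_tsubst: "tsubst \<sigma> (tsubst \<theta> t) = tsubst (\<lambda>z. tsubst \<sigma> (\<theta> z)) t"
  by (induction t) auto

lemma tvars_tsubst: "tvars (tsubst \<theta> t) = (\<Union>x\<in>tvars t. tvars (\<theta> x))"
  by (induction t) auto

lemma tsubst_upd_fresh [simp]: "y \<notin> tvars t \<Longrightarrow> tsubst (\<theta>(y := u)) t = tsubst \<theta> t"
  by (rule tsubst_cong) auto

text \<open>An equality and not just an equivalence up to renaming: \<open>variant\<close> renames
  only on a clash, and the identity causes none. Thus \<open>inst A y (Var y)\<close> is literally
  \<open>A\<close>, and \<open>AllI\<close> can generalize a variable in place.\<close>

lemma fsubst_Var [simp]: "fsubst Var \<phi> = \<phi>"
proof (induction \<phi>)
  case (Forall x \<phi>)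
  have "variant x (fvars \<phi> - {x}) = x"
    by (simp add: variant_def)
  then show ?case
    using Forall by (simp add: Let_def)
qed (auto simp: map_idI)

lemma inst_same [simp]: "inst \<phi> x (Var x) = \<phi>"
  by (simp add: inst_def)

lemma subst_rel_cong:
  "subst_rel \<theta> \<phi> \<psi> \<Longrightarrow> (\<And>x. x \<in> fvars \<phi> \<Longrightarrow> \<theta> x = \<theta>' x) \<Longrightarrow> subst_rel \<theta>' \<phi> \<psi>"
proof (induction \<phi> arbitrary: \<theta> \<theta>' \<psi>)
  case (Eq t u)
  then show ?case using tsubst_cong[of t \<theta> \<theta>'] tsubst_cong[of u \<theta> \<theta>'] by auto
next
  case (Pred p ts)
  then show ?case by (auto intro!: tsubst_cong)
next
  case (Imp \<phi>1 \<phi>2)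
  then obtain \<psi>1 \<psi>2 where \<psi>: "\<psi> = Imp \<psi>1 \<psi>2" "subst_rel \<theta> \<phi>1 \<psi>1" "subst_rel \<theta> \<phi>2 \<psi>2"
    by auto
  have "subst_rel \<theta>' \<phi>1 \<psi>1" "subst_rel \<theta>' \<phi>2 \<psi>2"
    using Imp.IH(1)[OF \<psi>(2)] Imp.IH(2)[OF \<psi>(3)] Imp.prems(2) by auto
  then show ?case using \<psi>(1) by simp
next
  case (Forall x \<phi>)
  then obtain y \<chi> where \<chi>: "\<psi> = Forall y \<chi>" "snd y = snd x"
    "\<forall>z\<in>fvars \<phi> - {x}. y \<notin> tvars (\<theta> z)" "subst_rel (\<theta>(x := Var y)) \<phi> \<chi>"
    by auto
  have "subst_rel (\<theta>'(x := Var y)) \<phi> \<chi>"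
    by (rule Forall.IH[OF \<chi>(4)]) (use Forall.prems in auto)
  then show ?case using \<chi> Forall.prems by auto
qed auto

lemma fvars_subst_rel: "subst_rel \<theta> \<phi> \<psi> \<Longrightarrow> fvars \<psi> = (\<Union>x\<in>fvars \<phi>. tvars (\<theta> x))"
proof (induction \<phi> arbitrary: \<theta> \<psi>)
  case (Imp \<phi>1 \<phi>2)
  then show ?case by fastforce
next
  case (Forall x \<phi>)
  then obtain y \<chi> where \<chi>: "\<psi> = Forall y \<chi>" "snd y = snd x"
    "\<forall>z\<in>fvars \<phi> - {x}. y \<notin> tvars (\<theta> z)" "subst_rel (\<theta>(x := Var y)) \<phi> \<chi>"
    by auto
  show ?case using Forall.IH[OF \<chi>(4)] \<chi>(1,3) by (auto split: if_splits)
qed (auto simp: tvars_tsubst)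

lemma subst_rel_refl: "subst_rel Var \<phi> \<phi>"
  by (induction \<phi>) (auto simp: map_idI)

text \<open>The name that \<open>fsubst\<close> selects avoids the variables of
  \<open>\<sigma> w\<close> for all \<open>w\<close> free under the binder. These \<open>w\<close>
  include the variables of \<open>\<theta> z\<close> for the relevant \<open>z\<close>, so the name
  is admissible for the composed substitution too.\<close>

lemma subst_rel_fsubst:
  "subst_rel \<theta> \<phi> \<psi> \<Longrightarrow> subst_rel (\<lambda>z. tsubst \<sigma> (\<theta> z)) \<phi> (fsubst \<sigma> \<psi>)"
proof (induction \<phi> arbitrary: \<theta> \<sigma> \<psi>)
  case (Forall x \<phi>)
  then obtain y \<chi> where \<chi>: "\<psi> = Forall y \<chi>" "snd y = snd x"
    "\<forall>z\<in>fvars \<phi> - {x}. y \<notin> tvars (\<theta> z)" "subst_rel (\<theta>(x := Var y)) \<phi> \<chi>"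
    by auto
  define V where "V = (\<Union>w\<in>fvars \<chi> - {y}. tvars (\<sigma> w))"
  define y' where "y' = variant y V"
  have y': "y' \<notin> V"
    unfolding y'_def by (rule variant_fresh) (simp add: V_def)
  have fresh: "y' \<notin> tvars (tsubst \<sigma> (\<theta> z))" if z: "z \<in> fvars \<phi> - {x}" for z
  proof -
    have "tvars (\<theta> z) \<subseteq> fvars \<chi> - {y}"
      using z \<chi>(3) by (auto simp: fvars_subst_rel[OF \<chi>(4)])
    then show ?thesis
      using y' by (auto simp: V_def tvars_tsubst)
  qed
  have "subst_rel (\<lambda>z. tsubst (\<sigma>(y := Var y')) ((\<theta>(x := Var y)) z)) \<phi> (fsubst (\<sigma>(y := Var y')) \<chi>)"
    by (rule Forall.IH[OF \<chi>(4)])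
  \<comment> \<open>At \<open>x\<close> both substitutions give \<open>Var y'\<close>; at the other
    free variables \<open>y\<close> does not occur in \<open>\<theta> z\<close>, so the update of
    \<open>\<sigma>\<close> at \<open>y\<close> has no effect.\<close>
  then have "subst_rel ((\<lambda>z. tsubst \<sigma> (\<theta> z))(x := Var y')) \<phi> (fsubst (\<sigma>(y := Var y')) \<chi>)"
    by (rule subst_rel_cong) (use \<chi>(3) in auto)
  moreover have "fsubst \<sigma> \<psi> = Forall y' (fsubst (\<sigma>(y := Var y')) \<chi>)"
    by (simp add: \<chi>(1) y'_def V_def Let_def)
  ultimately show ?case
    using fresh \<chi>(2) by (simp add: y'_def)
next
  case (Imp \<phi>1 \<phi>2)
  then show ?case by fastforce
qed (auto simp: tsubst_tsubst)

lemma subst_rel_fsubst_self: "subst_rel \<theta> \<phi> (fsubst \<theta> \<phi>)"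
  using subst_rel_fsubst[OF subst_rel_refl, of \<theta> \<phi>] by simp

text \<open>For the quantifier case of the truth lemma: an instance of an already substituted body
  is again a substitution instance of the original body.\<close>

lemma subst_rel_inst:
  assumes "subst_rel (\<theta>(x := Var y)) \<phi> \<chi>" "\<forall>z\<in>fvars \<phi> - {x}. y \<notin> tvars (\<theta> z)"
  shows "subst_rel (\<theta>(x := t)) \<phi> (inst \<chi> y t)"
  using subst_rel_fsubst[OF assms(1), of "Var(y := t)"] unfolding inst_def
  by (rule subst_rel_cong) (use assms(2) in auto)

lemma fvars_inst: "fvars (inst \<phi> x t) = (\<Union>y\<in>fvars \<phi>. tvars ((Var(x := t)) y))"
  unfolding inst_def by (rule fvars_subst_rel) (rule subst_rel_fsubst_self)

lemma has_sort_tsubst: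
  "has_sort L t \<sigma> \<Longrightarrow> (\<And>x. has_sort L (\<theta> x) (snd x)) \<Longrightarrow> has_sort L (tsubst \<theta> t) \<sigma>"
  by (induction t arbitrary: \<sigma>) (auto simp: list_all2_conv_all_nth)

lemma is_formula_subst_rel:
  "subst_rel \<theta> \<phi> \<psi> \<Longrightarrow> is_formula L \<phi> \<Longrightarrow> (\<And>x. has_sort L (\<theta> x) (snd x)) \<Longrightarrow> is_formula L \<psi>"
proof (induction \<phi> arbitrary: \<theta> \<psi>)
  case (Forall x \<phi>)
  then obtain y \<chi> where \<chi>: "\<psi> = Forall y \<chi>" "snd y = snd x" "subst_rel (\<theta>(x := Var y)) \<phi> \<chi>"
    by auto
  have "is_formula L \<chi>"
    by (rule Forall.IH[OF \<chi>(3)]) (use Forall.prems \<chi>(2) in auto)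
  then show ?case using \<chi>(1) by simp
next
  case (Imp \<phi>1 \<phi>2)
  then show ?case by fastforce
next
  case (Eq t u)
  then show ?case using has_sort_tsubst[of L _ _ \<theta>] by fastforce
qed (auto simp: list_all2_conv_all_nth intro: has_sort_tsubst)

lemma is_formula_fsubst:
  "is_formula L \<phi> \<Longrightarrow> (\<And>x. has_sort L (\<theta> x) (snd x)) \<Longrightarrow> is_formula L (fsubst \<theta> \<phi>)"
  by (rule is_formula_subst_rel[OF subst_rel_fsubst_self])

lemma is_formula_inst:
  "is_formula L \<phi> \<Longrightarrow> has_sort L t (snd x) \<Longrightarrow> is_formula L (inst \<phi> x t)"
  unfolding inst_def by (rule is_formula_fsubst) auto

lemma teval_cong: "(\<And>x. x \<in> tvars t \<Longrightarrow> e x = e' x) \<Longrightarrow> teval M e t = teval M e' t"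
proof (induction t)
  case (Fun f ts)
  then have "map (teval M e) ts = map (teval M e') ts" by auto
  then show ?case by (simp only: teval.simps)
qed auto

lemma sat_cong: "(\<And>x. x \<in> fvars \<phi> \<Longrightarrow> e x = e' x) \<Longrightarrow> sat M e \<phi> \<longleftrightarrow> sat M e' \<phi>"
proof (induction \<phi> arbitrary: e e')
  case (Eq t u)
  then show ?case using teval_cong[of t e e' M] teval_cong[of u e e' M] by auto
next
  case (Pred p ts)
  then have "map (teval M e) ts = map (teval M e') ts" by (auto intro!: teval_cong)
  then show ?case by (simp only: sat.simps)
next
  case (Imp \<phi>1 \<phi>2)
  have "sat M e \<phi>1 \<longleftrightarrow> sat M e' \<phi>1" "sat M e \<phi>2 \<longleftrightarrow> sat M e' \<phi>2"
    by (rule Imp.IH; use Imp.prems in auto)+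
  then show ?case by simp
next
  case (Forall x \<phi>)
  have "sat M (e(x := a)) \<phi> \<longleftrightarrow> sat M (e'(x := a)) \<phi>" for a
    by (rule Forall.IH) (use Forall.prems in auto)
  then show ?case by simp
qed auto

lemma teval_tsubst: "teval M e (tsubst \<theta> t) = teval M (\<lambda>z. teval M e (\<theta> z)) t"
proof (induction t)
  case (Fun f ts)
  then have "map (teval M e) (map (tsubst \<theta>) ts) = map (teval M (\<lambda>z. teval M e (\<theta> z))) ts" by auto
  then show ?case by (simp only: tsubst.simps teval.simps)
qed auto

lemma sat_subst_rel:
  "subst_rel \<theta> \<phi> \<psi> \<Longrightarrow> sat M e \<psi> \<longleftrightarrow> sat M (\<lambda>z. teval M e (\<theta> z)) \<phi>"
proof (induction \<phi> arbitrary: \<theta> \<psi> e)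
  case (Eq t u)
  then show ?case by (simp add: teval_tsubst)
next
  case (Pred p ts)
  then have "map (teval M e) (map (tsubst \<theta>) ts) = map (teval M (\<lambda>z. teval M e (\<theta> z))) ts"
    by (auto simp: teval_tsubst)
  then show ?case using Pred by (simp only: subst_rel.simps sat.simps)
next
  case (Imp \<phi>1 \<phi>2)
  then show ?case by fastforce
next
  case (Forall x \<phi>)
  then obtain y \<chi> where \<chi>: "\<psi> = Forall y \<chi>" "snd y = snd x"
    "\<forall>z\<in>fvars \<phi> - {x}. y \<notin> tvars (\<theta> z)" "subst_rel (\<theta>(x := Var y)) \<phi> \<chi>"
    by auto
  have "sat M (e(y := a)) \<chi> \<longleftrightarrow> sat M ((\<lambda>z. teval M e (\<theta> z))(x := a)) \<phi>" for a
    unfolding Forall.IH[OF \<chi>(4)]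
    by (rule sat_cong) (use \<chi>(3) in \<open>auto intro!: teval_cong\<close>)
  then show ?case using \<chi>(1,2) by simp
qed auto

lemma sat_inst: "sat M e (inst \<phi> x t) \<longleftrightarrow> sat M (e(x := teval M e t)) \<phi>"
proof -
  have "(\<lambda>z. teval M e ((Var(x := t)) z)) = e(x := teval M e t)" by auto
  then show ?thesis
    using sat_subst_rel[OF subst_rel_fsubst_self, of M e "Var(x := t)" \<phi>] by (simp add: inst_def)
qed

section \<open>Provability from a set of assumptions\<close>

text \<open>
  Weakening of \<^const>\<open>derivable\<close> would require renaming eigenvariables.  The following closure of
  the theorems under modus ponens admits weakening for trivial reasons.
\<close>

inductive prv :: "('s, 'f, 'p) language \<Rightarrow> ('s, 'f, 'p) fm set \<Rightarrow> ('s, 'f, 'p) fm \<Rightarrow> bool" for L T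
  where
  prv_assm: "\<phi> \<in> T \<Longrightarrow> is_formula L \<phi> \<Longrightarrow> prv L T \<phi>"
| prv_thm: "derivable L {} \<phi> \<Longrightarrow> is_formula L \<phi> \<Longrightarrow> prv L T \<phi>"
| prv_mp: "prv L T (Imp \<phi> \<psi>) \<Longrightarrow> prv L T \<phi> \<Longrightarrow> prv L T \<psi>"

lemma prv_is_formula: "prv L T \<phi> \<Longrightarrow> is_formula L \<phi>"
  by (induction rule: prv.induct) auto

lemma prv_mono: "prv L T \<phi> \<Longrightarrow> T \<subseteq> T' \<Longrightarrow> prv L T' \<phi>"
  by (induction rule: prv.induct) (auto intro: prv.intros)

lemma derivable_if_prv_empty: "prv L {} \<phi> \<Longrightarrow> derivable L {} \<phi>"
proof (induction rule: prv.induct)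
  case (prv_mp \<phi> \<psi>)
  show ?case by (rule ImpE[OF prv_mp.IH])
qed auto

lemma thm_K:
  assumes "is_formula L A" "is_formula L B"
  shows "derivable L {} (Imp A (Imp B A))"
  by (intro ImpI Assm) (use assms in auto)

lemma thm_S:
  assumes "is_formula L A" "is_formula L B" "is_formula L C"
  shows "derivable L {} (Imp (Imp A (Imp B C)) (Imp (Imp A B) (Imp A C)))"
proof (intro ImpI)
  let ?G = "{A, Imp A B, Imp A (Imp B C)}"
  have G: "derivable L ?G (Imp A (Imp B C))" "derivable L ?G (Imp A B)" "derivable L ?G A"
    by (intro Assm; use assms in simp)+
  show "derivable L ?G C"
    by (rule ImpE[OF ImpE[OF G(1,3)] ImpE[OF G(2,3)]])
qed (use assms in auto)

lemma thm_DN: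
  assumes "is_formula L A"
  shows "derivable L {} (Imp (Imp (Neg A) Bot) A)"
proof (intro ImpI)
  let ?G = "insert (Neg A) {Imp (Neg A) Bot}"
  have "derivable L ?G (Imp (Neg A) Bot)" "derivable L ?G (Neg A)"
    by (intro Assm; use assms in \<open>simp add: Neg_def\<close>)+
  then have "derivable L ?G Bot"
    by (rule ImpE)
  then show "derivable L {Imp (Neg A) Bot} A"
    using assms by (auto intro: Raa[OF assms])
qed (use assms in \<open>auto simp: Neg_def\<close>)

text \<open>The usual argument for Hilbert calculi: \<open>thm_K\<close> lifts assumptions and
  theorems, \<open>thm_S\<close> lifts modus ponens.\<close>

lemma prv_deduct:
  "prv L (insert A T) B \<Longrightarrow> is_formula L A \<Longrightarrow> prv L T (Imp A B)"
proof (induction rule: prv.induct)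
  case (prv_assm \<phi>)
  show ?case
  proof (cases "\<phi> = A")
    case True
    have "derivable L {} (Imp A A)"
      by (intro ImpI Assm) (use prv_assm in auto)
    then show ?thesis using True prv_assm by (auto intro: prv_thm)
  next
    case False
    have "prv L T (Imp \<phi> (Imp A \<phi>))"
      using prv_assm by (intro prv_thm thm_K) auto
    moreover have "prv L T \<phi>"
      using False prv_assm by (auto intro: prv.prv_assm)
    ultimately show ?thesis by (rule prv_mp)
  qed
next
  case (prv_thm \<phi>)
  have "prv L T (Imp \<phi> (Imp A \<phi>))"
    using prv_thm by (intro prv.prv_thm thm_K) auto
  moreover have "prv L T \<phi>"
    using prv_thm by (auto intro: prv.prv_thm)
  ultimately show ?case by (rule prv_mp)
next
  case (prv_mp \<phi> \<psi>)
  have f: "is_formula L A" "is_formula L \<phi>" "is_formula L \<psi>"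
    using prv_is_formula[OF prv_mp.hyps(1)] prv_mp.prems by auto
  have "prv L T (Imp (Imp A (Imp \<phi> \<psi>)) (Imp (Imp A \<phi>) (Imp A \<psi>)))"
    using f by (intro prv_thm thm_S) auto
  then show ?case
    by (rule prv.prv_mp[OF prv.prv_mp]) (use prv_mp.IH prv_mp.prems in auto)
qed

lemma prv_raa:
  assumes "prv L (insert (Neg A) T) Bot" "is_formula L A"
  shows "prv L T A"
proof -
  have "prv L T (Imp (Neg A) Bot)"
    using assms by (intro prv_deduct) (auto simp: Neg_def)
  moreover have "prv L T (Imp (Imp (Neg A) Bot) A)"
    using assms by (intro prv_thm thm_DN) (auto simp: Neg_def)
  ultimately show ?thesis by (rule prv_mp[rotated])
qed

lemma prv_Forall_vacuous:
  assumes "is_formula L A" "y \<notin> fvars A" "prv L T A"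
  shows "prv L T (Forall y A)"
proof -
  have "derivable L {A} (Forall y A)"
    using assms by (intro AllI[where y = y]) (auto intro: Assm)
  then have "prv L T (Imp A (Forall y A))"
    using assms by (intro prv_thm ImpI) auto
  then show ?thesis using assms(3) by (rule prv_mp)
qed

lemma prv_Forall_mp:
  assumes "prv L T (Forall y (Imp A B))" "prv L T (Forall y A)"
  shows "prv L T (Forall y B)"
proof -
  have f: "is_formula L A" "is_formula L B"
    using prv_is_formula[OF assms(1)] by auto
  let ?G = "{Forall y A, Forall y (Imp A B)}"
  have "derivable L ?G (inst (Imp A B) y (Var y))" "derivable L ?G (inst A y (Var y))"
    by (intro AllE Assm; use f in simp)+
  then have "derivable L ?G (inst B y (Var y))"
    using ImpE[of L ?G A B] by simp
  then have "derivable L ?G (Forall y B)"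
    using f by (intro AllI[where y = y]) auto
  then have "prv L T (Imp (Forall y (Imp A B)) (Imp (Forall y A) (Forall y B)))"
    using f by (intro prv_thm ImpI) auto
  from prv_mp[OF prv_mp[OF this assms(1)] assms(2)] show ?thesis .
qed

text \<open>Generalization is admissible although \<open>prv\<close> has no such rule: vacuous
  quantification treats the members of \<open>T\<close>, \<open>AllI\<close> in the empty context
  the theorems, and distribution over implication modus ponens.\<close>

lemma prv_generalize:
  "prv L T A \<Longrightarrow> \<forall>C\<in>T. y \<notin> fvars C \<Longrightarrow> prv L T (Forall y A)"
proof (induction rule: prv.induct)
  case (prv_assm \<phi>)
  then show ?case by (auto intro: prv_Forall_vacuous prv.prv_assm)
next
  case (prv_thm \<phi>)
  then show ?case by (intro prv.prv_thm AllI[where y = y]) auto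
next
  case (prv_mp \<phi> \<psi>)
  then show ?case by (auto intro: prv_Forall_mp)
qed

text \<open>The instance is first generalized under the name \<open>y\<close>. The bound variable is
  then changed to \<open>x\<close> by a derivation with a single assumption, in which
  \<open>y\<close> is not free.\<close>

lemma prv_AllI:
  assumes "prv L T (inst A x (Var y))" "is_formula L A" "snd y = snd x"
    and "y \<notin> fvars (Forall x A)" "\<forall>C\<in>T. y \<notin> fvars C"
  shows "prv L T (Forall x A)"
proof -
  let ?B = "inst A x (Var y)"
  have f: "is_formula L ?B" using assms by (auto intro: prv_is_formula)
  have "derivable L {Forall y ?B} (inst ?B y (Var y))"
    using f by (intro AllE Assm) auto
  then have "derivable L {Forall y ?B} (Forall x A)"
    using assms by (intro AllI[where y = y]) auto
  then have "prv L T (Imp (Forall y ?B) (Forall x A))"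
    using f assms by (intro prv_thm ImpI) auto
  then show ?thesis
    using prv_generalize[OF assms(1,5)] by (rule prv_mp)
qed

lemma prv_AllE:
  assumes "prv L T (Forall x A)" "has_sort L t (snd x)"
  shows "prv L T (inst A x t)"
proof -
  have f: "is_formula L A" using prv_is_formula[OF assms(1)] by simp
  have "derivable L {} (Imp (Forall x A) (inst A x t))"
    using f assms by (intro ImpI AllE Assm) auto
  then have "prv L T (Imp (Forall x A) (inst A x t))"
    using f assms by (intro prv_thm) (auto intro: is_formula_inst)
  then show ?thesis using assms(1) by (rule prv_mp)
qed

lemma prv_EqI: "has_sort L t \<sigma> \<Longrightarrow> prv L T (Eq t t)"
  by (rule prv_thm) (auto intro: EqI)

lemma prv_EqE:
  assumes "prv L T (Eq t u)" "prv L T (inst A x t)"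
    and "is_formula L A" "has_sort L t (snd x)" "has_sort L u (snd x)"
  shows "prv L T (inst A x u)"
proof -
  let ?G = "{inst A x t, Eq t u}"
  have f: "is_formula L (inst A x t)" "is_formula L (inst A x u)" "is_formula L (Eq t u)"
    using assms by (auto intro: is_formula_inst)
  have "derivable L ?G (inst A x u)"
    by (rule EqE[OF assms(3-5)]) (intro Assm; use f in simp)+
  then have "prv L T (Imp (Eq t u) (Imp (inst A x t) (inst A x u)))"
    using f by (intro prv_thm ImpI) auto
  from prv_mp[OF prv_mp[OF this assms(1)] assms(2)] show ?thesis .
qed

text \<open>A derivation uses finitely many assumptions, and these lie together in one stage of the
  chain.\<close>

lemma prv_UN_chain:
  assumes "prv L (\<Union>n::nat. T n) A" "mono T"
  shows "\<exists>n. prv L (T n) A"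
  using assms(1)
proof (induction rule: prv.induct)
  case (prv_mp \<phi> \<psi>)
  then obtain m n where "prv L (T m) (Imp \<phi> \<psi>)" "prv L (T n) \<phi>" by auto
  then have "prv L (T (max m n)) (Imp \<phi> \<psi>)" "prv L (T (max m n)) \<phi>"
    using monoD[OF assms(2), of m "max m n"] monoD[OF assms(2), of n "max m n"]
    by (auto elim!: prv_mono)
  then show ?case by (intro exI) (rule prv.prv_mp)
qed (auto intro: prv.intros)

section \<open>Maximal consistent sets with witnesses\<close>

text \<open>Variables serve as Henkin witnesses, so the language need not be extended.\<close>

locale henkin =
  fixes L :: "('s, 'f, 'p) language" and T :: "('s, 'f, 'p) fm set"
  assumes formulas: "A \<in> T \<Longrightarrow> is_formula L A"
    and consistent: "\<not> prv L T Bot"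
    and maximal: "is_formula L A \<Longrightarrow> A \<notin> T \<Longrightarrow> prv L (insert A T) Bot"
    and witness: "Neg (Forall x B) \<in> T \<Longrightarrow> \<exists>y. snd y = snd x \<and> Neg (inst B x (Var y)) \<in> T"

text \<open>Finiteness of \<open>T\<close> provides a variable fresh for \<open>T\<close> and
  \<open>A\<close>. If adding the witness were inconsistent, \<open>insert A T\<close> would prove
  the instance, hence by generalization \<open>Forall x B\<close>, against its own element
  \<open>A\<close>.\<close>

lemma henkin_step:
  assumes T: "finite T" "\<not> prv L T Bot" "\<forall>C\<in>T. is_formula L C" and A: "is_formula L A"
  shows "\<exists>T'. T \<subseteq> T' \<and> finite T' \<and> \<not> prv L T' Bot \<and> (\<forall>C\<in>T'. is_formula L C) \<and>
    (\<not> prv L (insert A T) Bot \<longrightarrow> A \<in> T') \<and>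
    (\<forall>x B. A = Neg (Forall x B) \<longrightarrow> A \<in> T' \<longrightarrow>
      (\<exists>y. snd y = snd x \<and> Neg (inst B x (Var y)) \<in> T'))"
proof (cases "prv L (insert A T) Bot")
  case True
  \<comment> \<open>As \<open>T\<close> is consistent, \<open>A\<close> cannot lie in it, so both
    conditions on \<open>A\<close> hold vacuously with \<open>T\<close> itself as the
    extension.\<close>
  then have "A \<notin> T" using T by (metis insert_absorb)
  then show ?thesis using True T by (intro exI[of _ T]) auto
next
  case cons: False
  show ?thesis
  proof (cases "\<exists>x B. A = Neg (Forall x B)")
    case False
    then show ?thesis using cons T A by (intro exI[of _ "insert A T"]) auto
  next
    case True
    then obtain x B where AB: "A = Neg (Forall x B)" by auto
    let ?T = "insert A T"
    obtain y where y: "snd y = snd x" "y \<notin> (\<Union>C\<in>?T. fvars C)"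
      by (rule fresh_var[of "\<Union>C\<in>?T. fvars C" "snd x"]) (use T(1) in auto)
    let ?W = "Neg (inst B x (Var y))"
    have B: "is_formula L B" using A AB by (simp add: Neg_def)
    then have fW: "is_formula L (inst B x (Var y))" using y by (auto intro: is_formula_inst)
    have "\<not> prv L (insert ?W ?T) Bot"
    proof
      assume "prv L (insert ?W ?T) Bot"
      then have "prv L ?T (inst B x (Var y))" by (rule prv_raa[OF _ fW])
      then have "prv L ?T (Forall x B)"
        by (rule prv_AllI) (use B y AB in \<open>auto simp: Neg_def\<close>)
      moreover have "prv L ?T (Imp (Forall x B) Bot)"
        by (rule prv_assm) (use AB A in \<open>auto simp: Neg_def\<close>)
      ultimately show False using cons by (metis prv_mp)
    qed
    moreover have "\<forall>x' B'. A = Neg (Forall x' B') \<longrightarrow>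
        (\<exists>y. snd y = snd x' \<and> Neg (inst B' x' (Var y)) \<in> insert ?W ?T)"
      using AB y(1) by (intro allI impI exI[of _ y]) (simp add: Neg_def)
    moreover have "is_formula L ?W" using fW by (simp add: Neg_def)
    ultimately show ?thesis
      using T A by (intro exI[of _ "insert ?W ?T"]) blast
  qed
qed

text \<open>Lindenbaum's construction along an enumeration of all formulas. Every stage stays finite
  so that fresh witnesses never run out; the limit need not leave any variable fresh.\<close>

lemma henkin_extension:
  fixes L :: "('s, 'f, 'p) language"
  assumes "countable {A. is_formula L A}"
    and "finite T0" "\<not> prv L T0 Bot" "\<forall>C\<in>T0. is_formula L C"
  obtains T where "henkin L T" "T0 \<subseteq> T"
proof -
  let ?F = "{A. is_formula L A}"
  define en where "en = from_nat_into ?F"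
  have "Bot \<in> ?F" by simp
  then have ne: "?F \<noteq> {}" by blast
  have en_F: "is_formula L (en n)" for n
    using from_nat_into[OF ne] by (simp add: en_def)
  have en_surj: "\<exists>n. en n = A" if "is_formula L A" for A
    using from_nat_into_surj[OF assms(1), of A] that by (auto simp: en_def)
  let ?P = "\<lambda>(n::nat) T. finite T \<and> \<not> prv L T Bot \<and> (\<forall>C\<in>T. is_formula L C) \<and> T0 \<subseteq> T"
  let ?Q = "\<lambda>n T T'. T \<subseteq> T' \<and> (\<not> prv L (insert (en n) T) Bot \<longrightarrow> en n \<in> T') \<and>
    (\<forall>x B. en n = Neg (Forall x B) \<longrightarrow> en n \<in> T' \<longrightarrow>
      (\<exists>y. snd y = snd x \<and> Neg (inst B x (Var y)) \<in> T'))"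
  have "\<exists>T. \<forall>n. ?P n (T n) \<and> ?Q n (T n) (T (Suc n))"
  proof (rule dependent_nat_choice)
    show "\<exists>T. ?P 0 T" using assms by auto
    fix T n
    assume "?P n T"
    then show "\<exists>T'. ?P (Suc n) T' \<and> ?Q n T T'"
      using henkin_step[of T L "en n"] en_F[of n] by (elim conjE) (smt (verit) subset_trans)
  qed
  then obtain T where T: "\<forall>n. ?P n (T n) \<and> ?Q n (T n) (T (Suc n))" by (rule exE)
  have P: "?P n (T n)" for n using T[rule_format, of n] by (rule conjunct1)
  have Q: "?Q n (T n) (T (Suc n))" for n using T[rule_format, of n] by (rule conjunct2)
  have mono: "mono T"
    unfolding mono_iff_le_Suc using Q by (intro allI) (rule conjunct1)
  show thesis
  proof
    show "T0 \<subseteq> (\<Union>n. T n)" using P by blast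
    show "henkin L (\<Union>n. T n)"
    proof
      show "\<And>A. A \<in> (\<Union>n. T n) \<Longrightarrow> is_formula L A" using P by blast
      show "\<not> prv L (\<Union>n. T n) Bot" using P prv_UN_chain[OF _ mono] by blast
    next
      fix A assume A: "is_formula L A" "A \<notin> (\<Union>n. T n)"
      then obtain n where n: "en n = A" using en_surj by blast
      have "A \<notin> T (Suc n)" using A by blast
      then have "prv L (insert A (T n)) Bot"
        using Q[of n] n by blast
      then show "prv L (insert A (\<Union>n. T n)) Bot"
        by (rule prv_mono) blast
    next
      fix x B assume "Neg (Forall x B) \<in> (\<Union>n. T n)"
      then obtain m where m: "Neg (Forall x B) \<in> T m" by blast
      then obtain n where n: "en n = Neg (Forall x B)" using en_surj P by blast
      \<comment> \<open>The formula may have entered at any stage \<open>m\<close>, possibly as a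
        witness for another one. Its presence in the consistent set \<open>T (max m n)\<close> shows
        it consistent with \<open>T n\<close>, so stage \<open>n\<close> treats it and supplies its
        witness.\<close>
      have "\<not> prv L (insert (en n) (T n)) Bot"
      proof
        assume "prv L (insert (en n) (T n)) Bot"
        then have "prv L (T (max m n)) Bot"
          by (rule prv_mono)
            (use m n monoD[OF mono, of m "max m n"] monoD[OF mono, of n "max m n"] in auto)
        then show False using P by blast
      qed
      then have "en n \<in> T (Suc n)" using Q by blast
      then show "\<exists>y. snd y = snd x \<and> Neg (inst B x (Var y)) \<in> (\<Union>n. T n)"
        using Q[of n] n by (meson UN_I UNIV_I)
    qed
  qed
qed

lemma has_sort_unique: "has_sort L t \<sigma> \<Longrightarrow> has_sort L t \<tau> \<Longrightarrow> \<sigma> = \<tau>"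
  by (cases t) auto

lemma map_cong_list_all2:
  "list_all2 P xs ys \<Longrightarrow> (\<And>x y. x \<in> set xs \<Longrightarrow> P x y \<Longrightarrow> f x = g x) \<Longrightarrow> map f xs = map g xs"
  by (induction rule: list_all2_induct) auto

context henkin
begin

lemma closed:
  assumes "prv L T A"
  shows "A \<in> T"
proof (rule ccontr)
  assume "A \<notin> T"
  moreover have A: "is_formula L A" using assms by (rule prv_is_formula)
  ultimately have "prv L T (Imp A Bot)" using maximal by (intro prv_deduct) auto
  then have "prv L T Bot" using assms by (rule prv_mp)
  then show False using consistent by simp
qed

lemma prv_if_mem: "A \<in> T \<Longrightarrow> prv L T A"
  by (simp add: prv_assm formulas)

lemma mem_Imp_iff:
  assumes "is_formula L A" "is_formula L B"
  shows "Imp A B \<in> T \<longleftrightarrow> (A \<in> T \<longrightarrow> B \<in> T)"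
proof
  assume "Imp A B \<in> T"
  then show "A \<in> T \<longrightarrow> B \<in> T" using closed prv_if_mem prv_mp by metis
next
  assume imp: "A \<in> T \<longrightarrow> B \<in> T"
  show "Imp A B \<in> T"
  proof (rule closed, rule prv_deduct)
    show "prv L (insert A T) B"
    proof (cases "A \<in> T")
      case True
      then show ?thesis using imp prv_if_mem prv_mono by (metis subset_insertI)
    next
      case False
      then have "prv L (insert A T) Bot" using assms maximal by simp
      then have "prv L (insert (Neg B) (insert A T)) Bot" by (rule prv_mono) auto
      then show ?thesis using assms(2) by (rule prv_raa)
    qed
  qed fact
qed

lemma Bot_not_mem: "Bot \<notin> T"
  using consistent prv_if_mem by blast

lemma mem_Neg_iff: "is_formula L A \<Longrightarrow> Neg A \<in> T \<longleftrightarrow> A \<notin> T"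
  by (simp add: Neg_def mem_Imp_iff Bot_not_mem)

lemma mem_Forall_iff:
  assumes "is_formula L B"
  shows "Forall x B \<in> T \<longleftrightarrow> (\<forall>t. has_sort L t (snd x) \<longrightarrow> inst B x t \<in> T)"
proof (intro iffI allI impI)
  fix t assume "Forall x B \<in> T" "has_sort L t (snd x)"
  then show "inst B x t \<in> T" by (meson closed prv_AllE prv_if_mem)
next
  assume inst: "\<forall>t. has_sort L t (snd x) \<longrightarrow> inst B x t \<in> T"
  show "Forall x B \<in> T"
  proof (rule ccontr)
    assume "Forall x B \<notin> T"
    then have "Neg (Forall x B) \<in> T" using assms by (simp add: mem_Neg_iff)
    then obtain y where y: "snd y = snd x" "Neg (inst B x (Var y)) \<in> T"
      using witness by blast
    moreover have "is_formula L (inst B x (Var y))"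
      using assms y by (auto intro: is_formula_inst)
    ultimately show False using inst by (simp add: mem_Neg_iff)
  qed
qed

section \<open>Equality in a maximal consistent set\<close>

lemma Eq_sort:
  assumes "Eq t u \<in> T" "has_sort L t \<sigma>"
  shows "has_sort L u \<sigma>"
  using formulas[OF assms(1)] assms(2) has_sort_unique by (metis is_formula.simps(2))

lemma Eq_refl: "has_sort L t \<sigma> \<Longrightarrow> Eq t t \<in> T"
  by (intro closed prv_EqI)

lemma Eq_replace:
  assumes "Eq t u \<in> T" "has_sort L t (snd x)" "inst A x t \<in> T" "is_formula L A"
  shows "inst A x u \<in> T"
  by (rule closed, rule prv_EqE[where t = t])
    (use assms Eq_sort[OF assms(1,2)] in \<open>auto intro: prv_if_mem\<close>)

lemma Eq_sym:
  assumes "Eq t u \<in> T"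
  shows "Eq u t \<in> T"
proof -
  obtain \<sigma> where \<sigma>: "has_sort L t \<sigma>" using formulas[OF assms] by auto
  obtain z where z: "snd z = \<sigma>" "z \<notin> tvars t" by (rule fresh_var[OF finite_tvars])
  \<comment> \<open>Replacement in the context \<open>z = t\<close>, which at \<open>t\<close> is an
    instance of reflexivity.\<close>
  have "inst (Eq (Var z) t) z u \<in> T"
    by (rule Eq_replace[OF assms]) (use \<sigma> z in \<open>auto simp: inst_def intro: Eq_refl\<close>)
  then show ?thesis using z by (simp add: inst_def)
qed

lemma Eq_trans:
  assumes "Eq t u \<in> T" "Eq u v \<in> T"
  shows "Eq t v \<in> T"
proof -
  obtain \<sigma> where \<sigma>: "has_sort L t \<sigma>" "has_sort L u \<sigma>" using formulas[OF assms(1)] by auto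
  obtain z where z: "snd z = \<sigma>" "z \<notin> tvars t" by (rule fresh_var[OF finite_tvars])
  have "inst (Eq t (Var z)) z v \<in> T"
    by (rule Eq_replace[OF assms(2)]) (use \<sigma> z assms in \<open>auto simp: inst_def\<close>)
  then show ?thesis using z by (simp add: inst_def)
qed

text \<open>\<open>EqE\<close> handles one pair of terms, so arguments are exchanged one position at
  a time, with \<open>pre\<close> holding those already exchanged. \<open>G\<close> stands for a
  predicate or for an equation with an application on the right; \<open>V\<close> collects the
  variables of its fixed part.\<close>

lemma replace_args:
  assumes subst: "\<And>\<theta> us. (\<And>x. x \<in> V \<Longrightarrow> \<theta> x = Var x) \<Longrightarrow> fsubst \<theta> (G us) = G (map (tsubst \<theta>) us)"
    and V: "finite V"
    and form: "\<And>us. list_all2 (has_sort L) us ss \<Longrightarrow> is_formula L (G us)"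
  shows "list_all2 (\<lambda>t u. Eq t u \<in> T) ts us \<Longrightarrow> list_all2 (has_sort L) (pre @ ts) ss \<Longrightarrow>
    G (pre @ ts) \<in> T \<Longrightarrow> G (pre @ us) \<in> T"
proof (induction ts arbitrary: pre us)
  case (Cons t ts)
  then obtain u us' where us: "us = u # us'" "Eq t u \<in> T" "list_all2 (\<lambda>t u. Eq t u \<in> T) ts us'"
    by (auto simp: list_all2_Cons1)
  obtain ss1 \<sigma> ss2 where ss: "ss = ss1 @ \<sigma> # ss2" "list_all2 (has_sort L) pre ss1"
    "has_sort L t \<sigma>" "list_all2 (has_sort L) ts ss2"
    using Cons.prems(2) by (auto simp: list_all2_append1 list_all2_Cons1)
  define V' where "V' = V \<union> (\<Union>t\<in>set (pre @ ts). tvars t)"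
  \<comment> \<open>\<open>z\<close> marks the current position: it avoids \<open>V\<close> and all
    other arguments, so substituting for it changes nothing else.\<close>
  obtain z where z: "snd z = \<sigma>" "z \<notin> V'"
    by (rule fresh_var[of V' \<sigma>]) (use V in \<open>simp_all add: V'_def\<close>)
  have inst: "inst (G (pre @ Var z # ts)) z w = G (pre @ w # ts)" for w
  proof -
    have "map (tsubst (Var(z := w))) (pre @ Var z # ts) = pre @ w # ts"
      using z by (auto simp: V'_def intro!: map_idI)
    then show ?thesis
      unfolding inst_def using z by (subst subst) (auto simp: V'_def)
  qed
  have "inst (G (pre @ Var z # ts)) z u \<in> T"
  proof (rule Eq_replace[OF us(2)])
    show "is_formula L (G (pre @ Var z # ts))"
      using ss z by (intro form) (auto intro!: list_all2_appendI)
  qed (use ss z Cons.prems(3) inst in auto)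
  then have "G ((pre @ [u]) @ ts) \<in> T" by (simp add: inst)
  moreover have "list_all2 (has_sort L) ((pre @ [u]) @ ts) ss"
    using ss Eq_sort[OF us(2) ss(3)] by (auto intro!: list_all2_appendI)
  ultimately show ?case using Cons.IH[OF us(3), of "pre @ [u]"] us(1) by simp
qed auto

lemma Fun_cong:
  assumes "f \<in> funs L" "list_all2 (has_sort L) ts (fdom L f)" "list_all2 (\<lambda>t u. Eq t u \<in> T) ts us"
  shows "Eq (Fun f ts) (Fun f us) \<in> T"
proof -
  \<comment> \<open>The left side stays fixed, and the replacement starts from reflexivity at
    \<open>Fun f ts\<close>.\<close>
  let ?G = "\<lambda>us. Eq (Fun f ts) (Fun f us)"
  have "?G ([] @ us) \<in> T"
  proof (rule replace_args[OF _ _ _ assms(3), where V = "tvars (Fun f ts)" and ss = "fdom L f"])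
    fix \<theta> :: "'s var \<Rightarrow> ('s, 'f) tm" and us
    assume "\<And>x. x \<in> tvars (Fun f ts) \<Longrightarrow> \<theta> x = Var x"
    then have "tsubst \<theta> (Fun f ts) = tsubst Var (Fun f ts)"
      by (rule tsubst_cong)
    then show "fsubst \<theta> (?G us) = ?G (map (tsubst \<theta>) us)"
      by (simp add: map_idI)
  qed (use assms in \<open>auto intro: Eq_refl\<close>)
  then show ?thesis by simp
qed

lemma Pred_cong:
  assumes "p \<in> preds L" "list_all2 (has_sort L) ts (pdom L p)" "list_all2 (\<lambda>t u. Eq t u \<in> T) ts us"
    and "Pred p ts \<in> T"
  shows "Pred p us \<in> T"
  using replace_args[where G = "Pred p" and V = "{}" and ss = "pdom L p" and pre = "[]",
      OF _ _ _ assms(3)] assms by simp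

end

section \<open>The term model inside the prescribed type of elements\<close>

locale henkin_model = henkin L T
  for L :: "('s, 'f, 'p) language" and T :: "('s, 'f, 'p) fm set" +
  fixes code :: "('s, 'f) tm \<Rightarrow> 'u"
  assumes inj_code: "inj_on code {t. \<exists>\<sigma>. has_sort L t \<sigma>}"
begin

text \<open>Elements must have type \<open>'u\<close>, so a class is represented by the code of a
  chosen member. Terms equated in \<open>T\<close> are equated with the same terms, hence share the
  choice.\<close>

definition cls :: "('s, 'f) tm \<Rightarrow> 'u" where
  "cls t = code (SOME u. Eq t u \<in> T)"

definition tm_of :: "'u \<Rightarrow> ('s, 'f) tm" where
  "tm_of a = (SOME t. (\<exists>\<sigma>. has_sort L t \<sigma>) \<and> cls t = a)"

definition model :: "('u, 's, 'f, 'p) fo_structure" where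
  "model = \<lparr>univ = \<lambda>\<sigma>. cls ` {t. has_sort L t \<sigma>},
    finterp = \<lambda>f as. cls (Fun f (map tm_of as)),
    pinterp = \<lambda>p as. Pred p (map tm_of as) \<in> T\<rparr>"

lemma cls_eq_iff:
  assumes t: "has_sort L t \<sigma>" and u: "has_sort L u \<tau>"
  shows "cls t = cls u \<longleftrightarrow> Eq t u \<in> T"
proof
  assume "Eq t u \<in> T"
  then have "(\<lambda>v. Eq t v \<in> T) = (\<lambda>v. Eq u v \<in> T)"
    using Eq_sym Eq_trans by blast
  then show "cls t = cls u" by (simp add: cls_def)
next
  assume eq: "cls t = cls u"
  have t': "Eq t (SOME v. Eq t v \<in> T) \<in> T" and u': "Eq u (SOME v. Eq u v \<in> T) \<in> T"
    using Eq_refl[OF t] Eq_refl[OF u] by (auto intro: someI)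
  have "(SOME v. Eq t v \<in> T) = (SOME v. Eq u v \<in> T)"
    using inj_onD[OF inj_code] eq Eq_sort[OF t' t] Eq_sort[OF u' u] by (auto simp: cls_def)
  then show "Eq t u \<in> T" using t' u' Eq_sym Eq_trans by metis
qed

lemma tm_of_cls:
  assumes "has_sort L t \<sigma>"
  shows "Eq t (tm_of (cls t)) \<in> T"
proof -
  have "(\<exists>\<sigma>. has_sort L (tm_of (cls t)) \<sigma>) \<and> cls (tm_of (cls t)) = cls t"
    unfolding tm_of_def by (rule someI[of _ t]) (use assms in auto)
  then show ?thesis using cls_eq_iff[OF assms] by metis
qed

lemma tms_of_cls:
  assumes "list_all2 (has_sort L) ts ss"
  shows "list_all2 (\<lambda>t u. Eq t u \<in> T) ts (map tm_of (map cls ts))"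
    and "list_all2 (has_sort L) (map tm_of (map cls ts)) ss"
  using assms
proof (induction ts ss rule: list_all2_induct)
  case (Cons t ts \<sigma> ss)
  have "Eq t (tm_of (cls t)) \<in> T" by (rule tm_of_cls) (rule Cons.hyps)
  moreover from this have "has_sort L (tm_of (cls t)) \<sigma>" by (rule Eq_sort) (rule Cons.hyps)
  ultimately show "list_all2 (\<lambda>t u. Eq t u \<in> T) (t # ts) (map tm_of (map cls (t # ts)))"
    "list_all2 (has_sort L) (map tm_of (map cls (t # ts))) (\<sigma> # ss)"
    using Cons.IH by simp_all
qed simp_all

text \<open>\<open>model\<close> evaluates \<open>f\<close> at chosen representatives of its
  arguments; \<open>Fun_cong\<close> makes the choice immaterial.\<close>

lemma finterp_model:
  assumes "f \<in> funs L" "list_all2 (has_sort L) ts (fdom L f)"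
  shows "finterp model f (map cls ts) = cls (Fun f ts)"
proof -
  have "Eq (Fun f ts) (Fun f (map tm_of (map cls ts))) \<in> T"
    using assms tms_of_cls by (blast intro: Fun_cong)
  moreover have "has_sort L (Fun f (map tm_of (map cls ts))) (fcod L f)" "has_sort L (Fun f ts) (fcod L f)"
    using assms tms_of_cls(2)[OF assms(2)] by auto
  ultimately have "cls (Fun f ts) = cls (Fun f (map tm_of (map cls ts)))"
    using cls_eq_iff by metis
  then show ?thesis by (simp add: model_def)
qed

lemma pinterp_model:
  assumes "p \<in> preds L" "list_all2 (has_sort L) ts (pdom L p)"
  shows "pinterp model p (map cls ts) \<longleftrightarrow> Pred p ts \<in> T"
proof -
  note eq = tms_of_cls[OF assms(2)]
  have "list_all2 (\<lambda>t u. Eq t u \<in> T) (map tm_of (map cls ts)) ts"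
    using eq(1) Eq_sym by (simp add: list_all2_conv_all_nth)
  then have "Pred p (map tm_of (map cls ts)) \<in> T \<longleftrightarrow> Pred p ts \<in> T"
    using Pred_cong[OF assms(1)] eq assms(2) by blast
  then show ?thesis by (simp add: model_def)
qed

lemma is_structure_model: "is_structure L model"
  unfolding is_structure_def
proof (intro conjI ballI allI impI)
  fix \<sigma>
  have "has_sort L (Var (0, \<sigma>)) \<sigma>" by simp
  then show "univ model \<sigma> \<noteq> {}" by (auto simp: model_def simp del: has_sort.simps)
next
  fix f as
  assume f: "f \<in> funs L" and as: "list_all2 (\<lambda>a \<sigma>. a \<in> univ model \<sigma>) as (fdom L f)"
  have "\<exists>ts. as = map cls ts \<and> list_all2 (has_sort L) ts ss"
    if "list_all2 (\<lambda>a \<sigma>. a \<in> univ model \<sigma>) as ss" for ss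
    using that
  proof (induction as ss rule: list_all2_induct)
    case (Cons a as \<sigma> ss)
    obtain t where "a = cls t" "has_sort L t \<sigma>" using Cons.hyps by (auto simp: model_def)
    moreover obtain ts where "as = map cls ts" "list_all2 (has_sort L) ts ss" using Cons.IH by blast
    ultimately show ?case by (intro exI[of _ "t # ts"]) simp
  qed auto
  then obtain ts where ts: "as = map cls ts" "list_all2 (has_sort L) ts (fdom L f)" using as by blast
  then have "has_sort L (Fun f ts) (fcod L f)" using f by simp
  then show "finterp model f as \<in> univ model (fcod L f)"
    using finterp_model[OF f ts(2)] ts(1) by (auto simp: model_def)
qed

lemma teval_model:
  assumes "\<And>x. has_sort L (\<theta> x) (snd x)"
  shows "has_sort L t \<sigma> \<Longrightarrow> teval model (\<lambda>x. cls (\<theta> x)) t = cls (tsubst \<theta> t)"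
proof (induction t arbitrary: \<sigma>)
  case (Fun f ts)
  then have f: "f \<in> funs L" "list_all2 (has_sort L) ts (fdom L f)" by auto
  then have "list_all2 (has_sort L) (map (tsubst \<theta>) ts) (fdom L f)"
    using assms by (auto simp: list_all2_conv_all_nth intro: has_sort_tsubst)
  moreover have "map (teval model (\<lambda>x. cls (\<theta> x))) ts = map cls (map (tsubst \<theta>) ts)"
    unfolding map_map by (rule map_cong_list_all2[OF f(2)]) (simp add: Fun.IH)
  ultimately show ?case
    using finterp_model[OF f(1)] by (simp only: teval.simps tsubst.simps)
qed auto

text \<open>The truth lemma. Instances of a quantified formula are not subformulas of it, so the
  induction runs over the original \<open>\<phi>\<close> for all \<open>\<theta>\<close> at once.
  Stating it with \<open>subst_rel\<close> lets the quantifier case accept the bound names that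
  \<open>inst\<close> produces.\<close>

lemma sat_model_iff:
  "subst_rel \<theta> \<phi> \<psi> \<Longrightarrow> is_formula L \<phi> \<Longrightarrow> (\<And>x. has_sort L (\<theta> x) (snd x)) \<Longrightarrow>
    sat model (\<lambda>x. cls (\<theta> x)) \<phi> \<longleftrightarrow> \<psi> \<in> T"
proof (induction \<phi> arbitrary: \<theta> \<psi>)
  case Bot
  then show ?case by (simp add: Bot_not_mem)
next
  case (Eq t u)
  then obtain \<sigma> where \<sigma>: "has_sort L t \<sigma>" "has_sort L u \<sigma>" by auto
  have "has_sort L (tsubst \<theta> t) \<sigma>" "has_sort L (tsubst \<theta> u) \<sigma>"
    using \<sigma> Eq.prems(3) by (auto intro: has_sort_tsubst)
  then show ?case
    using Eq.prems(1) teval_model[OF Eq.prems(3) \<sigma>(1)] teval_model[OF Eq.prems(3) \<sigma>(2)]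
    by (simp add: cls_eq_iff)
next
  case (Pred p ts)
  then have p: "p \<in> preds L" "list_all2 (has_sort L) ts (pdom L p)" by auto
  then have "list_all2 (has_sort L) (map (tsubst \<theta>) ts) (pdom L p)"
    using Pred.prems(3) by (auto simp: list_all2_conv_all_nth intro: has_sort_tsubst)
  moreover have "map (teval model (\<lambda>x. cls (\<theta> x))) ts = map cls (map (tsubst \<theta>) ts)"
    unfolding map_map
    by (rule map_cong_list_all2[OF p(2)]) (simp add: teval_model[OF Pred.prems(3)])
  ultimately show ?case
    using pinterp_model[OF p(1)] Pred.prems(1) by (simp only: sat.simps subst_rel.simps)
next
  case (Imp \<phi>1 \<phi>2)
  then obtain \<psi>1 \<psi>2 where \<psi>: "\<psi> = Imp \<psi>1 \<psi>2" "subst_rel \<theta> \<phi>1 \<psi>1" "subst_rel \<theta> \<phi>2 \<psi>2"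
    by auto
  have f: "is_formula L \<phi>1" "is_formula L \<phi>2" using Imp.prems(2) by auto
  have "is_formula L \<psi>1" "is_formula L \<psi>2"
    using is_formula_subst_rel[OF \<psi>(2) f(1) Imp.prems(3)]
      is_formula_subst_rel[OF \<psi>(3) f(2) Imp.prems(3)]
    by auto
  then show ?case
    using Imp.IH(1)[OF \<psi>(2) f(1) Imp.prems(3)] Imp.IH(2)[OF \<psi>(3) f(2) Imp.prems(3)] \<psi>(1)
    by (simp add: mem_Imp_iff)
next
  case (Forall x \<phi>)
  then obtain y \<chi> where \<chi>: "\<psi> = Forall y \<chi>" "snd y = snd x"
    "\<forall>z\<in>fvars \<phi> - {x}. y \<notin> tvars (\<theta> z)" "subst_rel (\<theta>(x := Var y)) \<phi> \<chi>"
    by auto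
  have f: "is_formula L \<phi>" using Forall.prems(2) by simp
  have f\<chi>: "is_formula L \<chi>"
    by (rule is_formula_subst_rel[OF \<chi>(4) f]) (use Forall.prems(3) \<chi>(2) in auto)
  have IH: "sat model ((\<lambda>x. cls (\<theta> x))(x := cls t)) \<phi> \<longleftrightarrow> inst \<chi> y t \<in> T" if "has_sort L t (snd x)" for t
  proof -
    have "sat model (\<lambda>z. cls ((\<theta>(x := t)) z)) \<phi> \<longleftrightarrow> inst \<chi> y t \<in> T"
      by (rule Forall.IH[OF subst_rel_inst[OF \<chi>(4,3)] f]) (use that Forall.prems(3) in auto)
    moreover have "(\<lambda>z. cls ((\<theta>(x := t)) z)) = (\<lambda>x. cls (\<theta> x))(x := cls t)" by auto
    ultimately show ?thesis by simp
  qed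
  have "sat model (\<lambda>x. cls (\<theta> x)) (Forall x \<phi>) \<longleftrightarrow>
      (\<forall>t. has_sort L t (snd x) \<longrightarrow> sat model ((\<lambda>x. cls (\<theta> x))(x := cls t)) \<phi>)"
    by (auto simp: model_def)
  also have "\<dots> \<longleftrightarrow> \<psi> \<in> T"
    using IH \<chi>(1,2) mem_Forall_iff[OF f\<chi>] by simp
  finally show ?case .
qed

end

section \<open>Completeness\<close>

lemma completeness_countable:
  fixes L :: "('s, 'f, 'p) language"
  assumes "countable {A. is_formula L A}" "infinite (UNIV :: 'u set)" "is_formula L \<phi>"
    and valid: "\<And>(M :: ('u, 's, 'f, 'p) fo_structure) e.
      is_structure L M \<Longrightarrow> is_assignment M e \<Longrightarrow> sat M e \<phi>"
  shows "derivable L {} \<phi>"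
proof (rule ccontr)
  assume "\<not> derivable L {} \<phi>"
  then have "\<not> prv L {Neg \<phi>} Bot"
    using prv_raa[of L \<phi> "{}"] derivable_if_prv_empty assms(3) by blast
  then obtain T where T: "henkin L T" "{Neg \<phi>} \<subseteq> T"
    using henkin_extension[OF assms(1), of "{Neg \<phi>}"] assms(3) by (auto simp: Neg_def)
  let ?W = "{t. \<exists>\<sigma>. has_sort L t \<sigma>}"
  \<comment> \<open>Terms inherit countability from formulas through the injection
    \<open>t \<mapsto> Eq t t\<close>.\<close>
  have "(\<lambda>t. Eq t t) ` ?W \<subseteq> {A. is_formula L A}" by auto
  then have "countable ((\<lambda>t. Eq t t :: ('s, 'f, 'p) fm) ` ?W)"
    using assms(1) countable_subset by blast
  then have "countable ?W"
    by (rule countable_image_inj_on) (auto intro: inj_onI)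
  moreover obtain k :: "nat \<Rightarrow> 'u" where "inj k"
    using infinite_countable_subset[OF assms(2)] by blast
  ultimately have "inj_on (\<lambda>t. k (to_nat_on ?W t)) ?W"
    by (intro inj_onI) (simp add: inj_eq)
  then interpret henkin_model L T "\<lambda>t. k (to_nat_on ?W t)"
    using T(1) by (simp add: henkin_model_def henkin_model_axioms_def)
  \<comment> \<open>With every variable denoting its own class, truth of \<open>\<phi>\<close>
    becomes membership in \<open>T\<close>.\<close>
  have "is_assignment model (\<lambda>x. cls (Var x))"
    by (auto simp: is_assignment_def model_def)
  then have "sat model (\<lambda>x. cls (Var x)) \<phi>"
    using valid is_structure_model by blast
  moreover have "sat model (\<lambda>x. cls (Var x)) \<phi> \<longleftrightarrow> \<phi> \<in> T"
    by (rule sat_model_iff[OF subst_rel_refl assms(3)]) simp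
  ultimately show False
    using T(2) mem_Neg_iff[OF assms(3)] by auto
qed

section \<open>From countable to arbitrary languages\<close>

instance tm :: (countable, countable) countable
  by countable_datatype

instance fm :: (countable, countable, countable) countable
  by countable_datatype

lemma finite_tm_funs: "finite (set2_tm t)"
  by (induction t) auto

lemma finite_fm_funs: "finite (set2_fm \<phi>)"
  by (induction \<phi>) (auto simp: finite_tm_funs)

lemma finite_fm_preds: "finite (set3_fm \<phi>)"
  by (induction \<phi>) auto

lemma has_sort_funs: "has_sort L t \<sigma> \<Longrightarrow> set2_tm t \<subseteq> funs L"
  by (induction t arbitrary: \<sigma>) (fastforce simp: list_all2_conv_all_nth in_set_conv_nth)+

lemma is_formula_funs: "is_formula L \<phi> \<Longrightarrow> set2_fm \<phi> \<subseteq> funs L"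
  by (induction \<phi>)
    (use has_sort_funs in \<open>fastforce simp: list_all2_conv_all_nth in_set_conv_nth\<close>)+

lemma is_formula_preds: "is_formula L \<phi> \<Longrightarrow> set3_fm \<phi> \<subseteq> preds L"
  by (induction \<phi>) auto

text \<open>The types \<open>'f\<close> and \<open>'p\<close> may be uncountable. Numbering the
  symbols of \<open>L\<close> sends its formulas injectively to formulas over natural numbers as
  symbols, which form a countable type.\<close>

lemma countable_formulas:
  fixes L :: "('s :: countable, 'f, 'p) language"
  assumes "countable (funs L)" "countable (preds L)"
  shows "countable {A. is_formula L A}"
proof -
  let ?h = "map_fm id (to_nat_on (funs L)) (to_nat_on (preds L)) :: _ \<Rightarrow> ('s, nat, nat) fm"
  have "inj_on ?h {A. is_formula L A}"
  proof (rule inj_onI)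
    fix A B assume *: "A \<in> {A. is_formula L A}" "B \<in> {A. is_formula L A}" "?h A = ?h B"
    show "A = B"
    proof (rule fm.inj_map_strong[OF _ _ _ *(3)])
      fix f g assume fg: "f \<in> set2_fm A" "g \<in> set2_fm B" "to_nat_on (funs L) f = to_nat_on (funs L) g"
      have "f \<in> funs L" "g \<in> funs L"
        using fg(1,2) *(1,2) is_formula_funs[of L A] is_formula_funs[of L B] by auto
      then show "f = g" using fg(3) assms(1) by simp
    next
      fix p q assume pq: "p \<in> set3_fm A" "q \<in> set3_fm B" "to_nat_on (preds L) p = to_nat_on (preds L) q"
      have "p \<in> preds L" "q \<in> preds L"
        using pq(1,2) *(1,2) is_formula_preds[of L A] is_formula_preds[of L B] by auto
      then show "p = q" using pq(3) assms(2) by simp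
    qed auto
  qed
  then show ?thesis
    by (rule countable_image_inj_on[OF countableI_type])
qed

abbreviation restrict_language ::
  "('s, 'f, 'p) language \<Rightarrow> 'f set \<Rightarrow> 'p set \<Rightarrow> ('s, 'f, 'p) language" where
  "restrict_language L F P \<equiv> L\<lparr>funs := F, preds := P\<rparr>"

lemma has_sort_restrict:
  "has_sort (restrict_language L F P) t \<sigma> \<Longrightarrow> F \<subseteq> funs L \<Longrightarrow> has_sort L t \<sigma>"
  by (induction t arbitrary: \<sigma>) (auto simp: list_all2_conv_all_nth)

lemma is_formula_restrict:
  "is_formula (restrict_language L F P) \<phi> \<Longrightarrow> F \<subseteq> funs L \<Longrightarrow> P \<subseteq> preds L \<Longrightarrow> is_formula L \<phi>"
  by (induction \<phi>) (auto simp: list_all2_conv_all_nth intro: has_sort_restrict)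

lemma has_sort_restrict_intro:
  "has_sort L t \<sigma> \<Longrightarrow> set2_tm t \<subseteq> F \<Longrightarrow> has_sort (restrict_language L F P) t \<sigma>"
  by (induction t arbitrary: \<sigma>) (fastforce simp: list_all2_conv_all_nth in_set_conv_nth)+

lemma is_formula_restrict_intro:
  "is_formula L \<phi> \<Longrightarrow> set2_fm \<phi> \<subseteq> F \<Longrightarrow> set3_fm \<phi> \<subseteq> P \<Longrightarrow>
    is_formula (restrict_language L F P) \<phi>"
proof (induction \<phi>)
  case (Eq t u)
  then show ?case using has_sort_restrict_intro[of L _ _ F P] by fastforce
next
  case (Pred p ts)
  then show ?case by (fastforce simp: list_all2_conv_all_nth intro!: has_sort_restrict_intro)
qed auto

text \<open>The rules consult the language only to check formulas and sorts, and these checks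
  persist in a larger language.\<close>

lemma derivable_restrict:
  assumes "derivable (restrict_language L F P) \<Gamma> \<phi>" "F \<subseteq> funs L" "P \<subseteq> preds L"
  shows "derivable L \<Gamma> \<phi>"
  using assms(1)
proof (induction rule: derivable.induct)
  case (Assm \<phi> \<Gamma>)
  then show ?case using assms by (auto intro: derivable.Assm is_formula_restrict)
next
  case (ImpI \<phi> \<Gamma> \<psi>)
  then show ?case using assms by (auto intro: derivable.ImpI is_formula_restrict)
next
  case (ImpE \<Gamma> \<phi> \<psi>)
  show ?case by (rule derivable.ImpE[OF ImpE.IH])
next
  case (Raa \<phi> \<Gamma>)
  show ?case
    by (rule derivable.Raa[OF _ Raa.IH]) (rule is_formula_restrict[OF Raa.hyps(1) assms(2,3)])
next
  case (AllI x \<phi> y \<Gamma>)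
  show ?case
    by (rule derivable.AllI[OF is_formula_restrict[OF AllI.hyps(1) assms(2,3)] AllI.hyps(2-4) AllI.IH])
next
  case (AllE \<Gamma> x \<phi> t)
  show ?case
    by (rule derivable.AllE[OF AllE.IH has_sort_restrict[OF AllE.hyps(2) assms(2)]])
next
  case (EqI t \<sigma> \<Gamma>)
  show ?case
    by (rule derivable.EqI[OF has_sort_restrict[OF EqI.hyps(1) assms(2)]])
next
  case (EqE \<phi> t x u \<Gamma>)
  show ?case
    by (rule derivable.EqE[OF is_formula_restrict[OF EqE.hyps(1) assms(2,3)]
          has_sort_restrict[OF EqE.hyps(2) assms(2)] has_sort_restrict[OF EqE.hyps(3) assms(2)] EqE.IH])
qed

lemma sat_finterp_cong:
  assumes "\<And>f. f \<in> funs L \<Longrightarrow> finterp M f = finterp M' f"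
    and "univ M = univ M'" "pinterp M = pinterp M'"
  shows "is_formula L \<phi> \<Longrightarrow> sat M e \<phi> \<longleftrightarrow> sat M' e \<phi>"
proof (induction \<phi> arbitrary: e)
  have *: "teval M e t = teval M' e t" if "has_sort L t \<sigma>" for e t \<sigma>
    using that
  proof (induction t arbitrary: \<sigma>)
    case (Fun f ts)
    then have "list_all2 (has_sort L) ts (fdom L f)" by simp
    then have "map (teval M e) ts = map (teval M' e) ts"
      by (rule map_cong_list_all2) (rule Fun.IH)
    then show ?case using Fun.prems assms(1) by (simp only: teval.simps has_sort.simps)
  qed auto
  {
    case (Eq t u)
    then show ?case using * by auto
  next
    case (Pred p ts)
    then have "list_all2 (has_sort L) ts (pdom L p)" by simp
    then have "map (teval M e) ts = map (teval M' e) ts"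
      by (rule map_cong_list_all2) (rule *)
    then show ?case using assms(3) by (simp only: sat.simps)
  }
qed (use assms(2) in auto)

text \<open>The derivation is found in the sublanguage of the finitely many symbols of
  \<open>\<phi>\<close>. Validity passes to that sublanguage because each of its structures can be
  changed into a structure for \<open>L\<close> without affecting \<open>\<phi>\<close>.\<close>

theorem completeness:
  fixes L :: "('s :: finite, 'f, 'p) language"
  assumes "infinite (UNIV :: 'u set)" and \<phi>: "is_formula L \<phi>"
    and valid: "\<And>(M :: ('u, 's, 'f, 'p) fo_structure) e.
      is_structure L M \<Longrightarrow> is_assignment M e \<Longrightarrow> sat M e \<phi>"
  shows "derivable L {} \<phi>"
proof (rule derivable_restrict[OF _ is_formula_funs[OF \<phi>] is_formula_preds[OF \<phi>]])
  let ?L = "restrict_language L (set2_fm \<phi>) (set3_fm \<phi>)"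
  have \<phi>': "is_formula ?L \<phi>" using \<phi> by (simp add: is_formula_restrict_intro)
  show "derivable ?L {} \<phi>"
  proof (rule completeness_countable[OF countable_formulas assms(1) \<phi>'])
    fix M :: "('u, 's, 'f, 'p) fo_structure" and e
    assume M: "is_structure ?L M" and e: "is_assignment M e"
    \<comment> \<open>Symbols outside \<open>\<phi>\<close> must still take values in their codomain
      carrier; a constant function with a chosen value there does so.\<close>
    let ?M = "M\<lparr>finterp := \<lambda>f as.
      if f \<in> set2_fm \<phi> then finterp M f as else SOME a. a \<in> univ M (fcod L f)\<rparr>"
    have "is_structure L ?M"
      using M by (auto simp: is_structure_def some_in_eq)
    then have "sat ?M e \<phi>"
      using valid e by (simp add: is_assignment_def)
    then show "sat M e \<phi>"
      using sat_finterp_cong[OF _ _ _ \<phi>', of M ?M e] by simp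
  qed (simp_all add: countable_finite finite_fm_funs finite_fm_preds)
qed

section \<open>Clause sets and existential induction\<close>

lemma sat_derived [simp]:
  "sat M e (Neg \<phi>) \<longleftrightarrow> \<not> sat M e \<phi>"
  "sat M e (Or \<phi> \<psi>) \<longleftrightarrow> sat M e \<phi> \<or> sat M e \<psi>"
  "sat M e (And \<phi> \<psi>) \<longleftrightarrow> sat M e \<phi> \<and> sat M e \<psi>"
  "sat M e (Exists x \<phi>) \<longleftrightarrow> (\<exists>a\<in>univ M (snd x). sat M (e(x := a)) \<phi>)"
  by (auto simp: Neg_def Or_def And_def Exists_def)

lemma fvars_derived [simp]:
  "fvars (Neg \<phi>) = fvars \<phi>"
  "fvars (Or \<phi> \<psi>) = fvars \<phi> \<union> fvars \<psi>"
  "fvars (And \<phi> \<psi>) = fvars \<phi> \<union> fvars \<psi>"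
  "fvars (Exists x \<phi>) = fvars \<phi> - {x}"
  by (auto simp: Neg_def Or_def And_def Exists_def)

lemma is_formula_derived [simp]:
  "is_formula L (Neg \<phi>) \<longleftrightarrow> is_formula L \<phi>"
  "is_formula L (Or \<phi> \<psi>) \<longleftrightarrow> is_formula L \<phi> \<and> is_formula L \<psi>"
  "is_formula L (And \<phi> \<psi>) \<longleftrightarrow> is_formula L \<phi> \<and> is_formula L \<psi>"
  "is_formula L (Exists x \<phi>) \<longleftrightarrow> is_formula L \<phi>"
  by (auto simp: Neg_def Or_def And_def Exists_def)

lemma quantifier_free_derived [simp]:
  "quantifier_free (Neg \<phi>) \<longleftrightarrow> quantifier_free \<phi>"
  "quantifier_free (Or \<phi> \<psi>) \<longleftrightarrow> quantifier_free \<phi> \<and> quantifier_free \<psi>"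
  by (auto simp: Neg_def Or_def)

lemma sat_Disj: "sat M e (Disj \<phi>s) \<longleftrightarrow> (\<exists>\<phi>\<in>set \<phi>s. sat M e \<phi>)"
  by (induction \<phi>s rule: Disj.induct) auto

lemma fvars_Disj: "fvars (Disj \<phi>s) = (\<Union>\<phi>\<in>set \<phi>s. fvars \<phi>)"
  by (induction \<phi>s rule: Disj.induct) auto

lemma is_formula_Disj: "is_formula L (Disj \<phi>s) \<longleftrightarrow> (\<forall>\<phi>\<in>set \<phi>s. is_formula L \<phi>)"
  by (induction \<phi>s rule: Disj.induct) auto

lemma quantifier_free_Disj: "quantifier_free (Disj \<phi>s) \<longleftrightarrow> (\<forall>\<phi>\<in>set \<phi>s. quantifier_free \<phi>)"
  by (induction \<phi>s rule: Disj.induct) auto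

lemma sat_Conj: "sat M e (Conj \<phi>s) \<longleftrightarrow> (\<forall>\<phi>\<in>set \<phi>s. sat M e \<phi>)"
  by (induction \<phi>s rule: Conj.induct) (auto simp: Top_def)

lemma fvars_Conj: "fvars (Conj \<phi>s) = (\<Union>\<phi>\<in>set \<phi>s. fvars \<phi>)"
  by (induction \<phi>s rule: Conj.induct) (auto simp: Top_def)

lemma is_formula_Conj: "is_formula L (Conj \<phi>s) \<longleftrightarrow> (\<forall>\<phi>\<in>set \<phi>s. is_formula L \<phi>)"
  by (induction \<phi>s rule: Conj.induct) (auto simp: Top_def)

lemma fvars_Forall_list [simp]: "fvars (Forall_list xs \<phi>) = fvars \<phi> - set xs"
  by (induction xs) (auto simp: Forall_list_def)

lemma is_formula_Forall_list [simp]: "is_formula L (Forall_list xs \<phi>) \<longleftrightarrow> is_formula L \<phi>"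
  by (induction xs) (auto simp: Forall_list_def)

lemma fvars_Exists_list [simp]: "fvars (Exists_list xs \<phi>) = fvars \<phi> - set xs"
  by (induction xs) (auto simp: Exists_list_def)

lemma is_formula_Exists_list [simp]: "is_formula L (Exists_list xs \<phi>) \<longleftrightarrow> is_formula L \<phi>"
  by (induction xs) (auto simp: Exists_list_def)

lemma quantifier_free_fsubst: "quantifier_free \<phi> \<Longrightarrow> quantifier_free (fsubst \<theta> \<phi>)"
  by (induction \<phi>) auto

lemma quantifier_free_literal: "is_literal \<phi> \<Longrightarrow> quantifier_free \<phi>"
  by (auto simp: is_literal_def is_atom_def)

lemma is_assignment_upd:
  "is_assignment M e \<Longrightarrow> a \<in> univ M (snd x) \<Longrightarrow> is_assignment M (e(x := a))"
  unfolding is_assignment_def by (metis fun_upd_apply)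

text \<open>Read as one quantification over assignments, a block is insensitive to order and
  repetition of its variables. This allows prefixes of different clauses to be concatenated.\<close>

lemma sat_Forall_list:
  "is_assignment M e \<Longrightarrow> sat M e (Forall_list xs \<phi>) \<longleftrightarrow>
    (\<forall>e'. is_assignment M e' \<longrightarrow> (\<forall>z. z \<notin> set xs \<longrightarrow> e' z = e z) \<longrightarrow> sat M e' \<phi>)"
proof (induction xs arbitrary: e)
  case Nil
  have "e' = e" if "\<forall>z. e' z = e z" for e' using that by auto
  then show ?case using Nil by (auto simp: Forall_list_def)
next
  case (Cons x xs)
  have "sat M e (Forall_list (x # xs) \<phi>) \<longleftrightarrow>
      (\<forall>a\<in>univ M (snd x). sat M (e(x := a)) (Forall_list xs \<phi>))"
    by (simp add: Forall_list_def)
  also have "\<dots> \<longleftrightarrow> (\<forall>a\<in>univ M (snd x). \<forall>e'. is_assignment M e' \<longrightarrow>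
      (\<forall>z. z \<notin> set xs \<longrightarrow> e' z = (e(x := a)) z) \<longrightarrow> sat M e' \<phi>)"
    by (rule ball_cong[OF refl], rule Cons.IH[OF is_assignment_upd[OF Cons.prems]])
  also have "\<dots> \<longleftrightarrow> (\<forall>e'. is_assignment M e' \<longrightarrow> (\<forall>z. z \<notin> set (x # xs) \<longrightarrow> e' z = e z) \<longrightarrow>
      sat M e' \<phi>)"
  proof (intro iffI allI impI ballI)
    fix e'
    assume *: "\<forall>a\<in>univ M (snd x). \<forall>e'. is_assignment M e' \<longrightarrow>
        (\<forall>z. z \<notin> set xs \<longrightarrow> e' z = (e(x := a)) z) \<longrightarrow> sat M e' \<phi>"
      and e': "is_assignment M e'" "\<forall>z. z \<notin> set (x # xs) \<longrightarrow> e' z = e z"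
    have "e' x \<in> univ M (snd x)" using e'(1) unfolding is_assignment_def by (rule spec)
    moreover have "\<forall>z. z \<notin> set xs \<longrightarrow> e' z = (e(x := e' x)) z" using e'(2) by simp
    ultimately show "sat M e' \<phi>" using * e'(1) by blast
  next
    fix a e'
    assume *: "\<forall>e'. is_assignment M e' \<longrightarrow> (\<forall>z. z \<notin> set (x # xs) \<longrightarrow> e' z = e z) \<longrightarrow> sat M e' \<phi>"
      and e': "is_assignment M e'" "\<forall>z. z \<notin> set xs \<longrightarrow> e' z = (e(x := a)) z"
    have "\<forall>z. z \<notin> set (x # xs) \<longrightarrow> e' z = e z" using e'(2) by simp
    then show "sat M e' \<phi>" using * e'(1) by blast
  qed
  finally show ?case .
qed

lemma sat_Exists_list_iff_Forall_list:
  "sat M e (Exists_list xs \<phi>) \<longleftrightarrow> \<not> sat M e (Forall_list xs (Neg \<phi>))"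
proof (induction xs arbitrary: e)
  case (Cons x xs)
  have "sat M e (Exists_list (x # xs) \<phi>) \<longleftrightarrow>
      (\<exists>a\<in>univ M (snd x). sat M (e(x := a)) (Exists_list xs \<phi>))"
    by (simp add: Exists_list_def)
  then show ?case unfolding Cons.IH by (simp add: Forall_list_def)
qed (simp add: Exists_list_def Forall_list_def)

lemma sat_Exists_list:
  "is_assignment M e \<Longrightarrow> sat M e (Exists_list xs \<phi>) \<longleftrightarrow>
    (\<exists>e'. is_assignment M e' \<and> (\<forall>z. z \<notin> set xs \<longrightarrow> e' z = e z) \<and> sat M e' \<phi>)"
  by (simp add: sat_Exists_list_iff_Forall_list sat_Forall_list)

text \<open>
  The free variable \<open>x\<close> may be bound in some of the clauses.  Replacing its free occurrences by
  the new variable \<open>x0\<close> makes it possible to prenex the negated clauses with one common prefix.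
\<close>

lemma negated_clause_set:
  assumes "is_clause_set L S" "fvars S \<subseteq> {x}"
  obtains x0 ys \<phi> where "snd x0 = snd x" "x0 \<notin> set ys" "quantifier_free \<phi>" "is_formula L \<phi>"
    "fvars \<phi> \<subseteq> insert x0 (set ys)"
    "\<And>(M :: ('u, 's, 'f, 'p) fo_structure) e. is_assignment M e \<Longrightarrow>
      sat M e (Exists_list ys \<phi>) \<longleftrightarrow> \<not> sat M (e(x := e x0)) S"
proof -
  obtain cs where S: "S = Conj cs" and cs: "\<forall>c\<in>set cs. is_clause L c"
    using assms(1) by (auto simp: is_clause_set_def)
  have "\<forall>c\<in>set cs. \<exists>p. c = Forall_list (fst p) (Disj (snd p)) \<and> (\<forall>l\<in>set (snd p). is_literal l)"
    using cs by (simp add: is_clause_def)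
  then obtain P where P: "\<forall>c\<in>set cs. c = Forall_list (fst (P c)) (Disj (snd (P c))) \<and>
      (\<forall>l\<in>set (snd (P c)). is_literal l)"
    by (rule bchoice[THEN exE])
  define Y where "Y c = fst (P c)" for c
  define D where "D c = Disj (snd (P c))" for c
  have c: "c = Forall_list (Y c) (D c)" if "c \<in> set cs" for c
    using P that by (simp add: Y_def D_def)
  have D_qf: "quantifier_free (D c)" if "c \<in> set cs" for c
    using P that by (simp add: D_def quantifier_free_Disj quantifier_free_literal)
  have D_form: "is_formula L (D c)" if "c \<in> set cs" for c
    using cs that c[OF that] is_formula_Forall_list[of L "Y c" "D c"] by (simp add: is_clause_def)
  have D_fvars: "fvars (D c) \<subseteq> insert x (set (Y c))" if "c \<in> set cs" for c
  proof -
    have "fvars c \<subseteq> {x}" using assms(2) that by (auto simp: S fvars_Conj)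
    then show ?thesis using c[OF that] fvars_Forall_list[of "Y c" "D c"] by auto
  qed
  obtain x0 where x0: "snd x0 = snd x" "x0 \<notin> insert x (\<Union>c\<in>set cs. set (Y c))"
    by (rule fresh_var[of "insert x (\<Union>c\<in>set cs. set (Y c))" "snd x"]) auto
  define ys where "ys = concat (map Y cs)"
  \<comment> \<open>If the clause binds \<open>x\<close>, its matrix is kept, as \<open>x\<close> is
    meant to be caught by \<open>ys\<close>. Otherwise \<open>x\<close> is free in the clause and
    might be caught by the prefix of another clause, so it becomes \<open>x0\<close>.\<close>
  define A where "A c = Neg (if x \<in> set (Y c) then D c else inst (D c) x (Var x0))" for c
  \<comment> \<open>\<open>shift c e\<close> is the assignment under which the matrix of
    \<open>c\<close> has to be read before the renaming.\<close>
  define shift where "shift c e = (if x \<in> set (Y c) then e else e(x := e x0))"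
    for c and e :: "'s var \<Rightarrow> 'u"
  have sat_A: "sat M e (A c) \<longleftrightarrow> \<not> sat M (shift c e) (D c)"
    for c e and M :: "('u, 's, 'f, 'p) fo_structure"
    by (simp add: A_def shift_def sat_inst)
  have fvars_A: "fvars (A c) \<subseteq> insert x0 (set (Y c))" if "c \<in> set cs" for c
    using D_fvars[OF that] by (auto simp: A_def fvars_inst split: if_splits)
  show thesis
  proof
    show "snd x0 = snd x" by fact
    show "x0 \<notin> set ys" using x0 by (simp add: ys_def)
    show "quantifier_free (Disj (map A cs))"
      using D_qf by (simp add: quantifier_free_Disj A_def inst_def quantifier_free_fsubst)
    show "is_formula L (Disj (map A cs))"
      using D_form x0(1) by (simp add: is_formula_Disj A_def is_formula_inst)
    show "fvars (Disj (map A cs)) \<subseteq> insert x0 (set ys)"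
      using fvars_A by (fastforce simp: fvars_Disj ys_def)
  next
    fix M :: "('u, 's, 'f, 'p) fo_structure" and e
    assume e: "is_assignment M e"
    let ?e = "e(x := e x0)"
    have e': "is_assignment M ?e" using e x0(1) by (metis is_assignment_def is_assignment_upd)
    have "sat M e (Exists_list ys (Disj (map A cs))) \<longleftrightarrow>
        (\<exists>c\<in>set cs. \<exists>e'. is_assignment M e' \<and> (\<forall>z. z \<notin> set ys \<longrightarrow> e' z = e z) \<and>
          \<not> sat M (shift c e') (D c))"
      by (auto simp: sat_Exists_list[OF e] sat_Disj sat_A)
    also have "\<dots> \<longleftrightarrow> (\<exists>c\<in>set cs. \<exists>e'. is_assignment M e' \<and> (\<forall>z. z \<notin> set (Y c) \<longrightarrow> e' z = ?e z) \<and>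
          \<not> sat M e' (D c))"
    proof (rule bex_cong[OF refl], intro iffI; elim exE conjE)
      fix c e' assume c: "c \<in> set cs" and h: "is_assignment M e'"
        "\<forall>z. z \<notin> set ys \<longrightarrow> e' z = e z" "\<not> sat M (shift c e') (D c)"
      \<comment> \<open>Values of \<open>e'\<close> outside \<open>Y c\<close> are discarded. There
        \<open>D c\<close> can mention at most \<open>x\<close>, and then \<open>shift\<close> and
        \<open>?e\<close> both give it the value \<open>e x0\<close>.\<close>
      let ?e' = "\<lambda>z. if z \<in> set (Y c) then e' z else ?e z"
      have "x0 \<notin> set ys" using x0(2) by (simp add: ys_def)
      then have "e' x0 = e x0" using h(2) by blast
      then have "sat M (shift c e') (D c) \<longleftrightarrow> sat M ?e' (D c)"
        by (intro sat_cong) (use D_fvars[OF c] in \<open>auto simp: shift_def\<close>)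
      moreover have "is_assignment M ?e'"
        using h(1) e' by (simp add: is_assignment_def)
      ultimately show "\<exists>e'. is_assignment M e' \<and> (\<forall>z. z \<notin> set (Y c) \<longrightarrow> e' z = ?e z) \<and>
          \<not> sat M e' (D c)"
        using h(3) by (intro exI[of _ ?e']) simp
    next
      fix c e' assume c: "c \<in> set cs" and h: "is_assignment M e'"
        "\<forall>z. z \<notin> set (Y c) \<longrightarrow> e' z = ?e z" "\<not> sat M e' (D c)"
      let ?e' = "\<lambda>z. if z \<in> set (Y c) then e' z else e z"
      have "x0 \<notin> set (Y c)" using x0(2) c by simp
      then have "sat M (shift c ?e') (D c) \<longleftrightarrow> sat M e' (D c)"
        by (intro sat_cong) (use D_fvars[OF c] h(2) in \<open>auto simp: shift_def\<close>)
      moreover have "is_assignment M ?e'"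
        using h(1) e by (simp add: is_assignment_def)
      moreover have "\<forall>z. z \<notin> set ys \<longrightarrow> ?e' z = e z" using c by (auto simp: ys_def)
      ultimately show "\<exists>e'. is_assignment M e' \<and> (\<forall>z. z \<notin> set ys \<longrightarrow> e' z = e z) \<and>
          \<not> sat M (shift c e') (D c)"
        using h(3) by (intro exI[of _ ?e']) simp
    qed
    also have "\<dots> \<longleftrightarrow> (\<exists>c\<in>set cs. \<not> sat M ?e (Forall_list (Y c) (D c)))"
      by (simp add: sat_Forall_list[OF e'])
    also have "\<dots> \<longleftrightarrow> \<not> sat M ?e S"
      unfolding S sat_Conj using c by metis
    finally show "sat M e (Exists_list ys (Disj (map A cs))) \<longleftrightarrow> \<not> sat M ?e S" .
  qed
qed

section \<open>Closed instances of existential induction\<close>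

lemma IE1_I:
  assumes "is_formula L \<phi>" "quantifier_free \<phi>" "snd x = nat_sort L" "fvars (Exists_list ys \<phi>) \<subseteq> {x}"
  shows "induction_fm L [] x (Exists_list ys \<phi>) \<in> IE1 L"
proof -
  have "\<exists>ys' \<phi>'. Exists_list ys \<phi> = Exists_list ys' \<phi>' \<and> quantifier_free \<phi>'"
    using assms(2) by blast
  moreover have "set [] = fvars (Exists_list ys \<phi>) - {x}" using assms(4) by auto
  ultimately show ?thesis
    unfolding IE1_def mem_Collect_eq using assms(1,3)
    by (intro exI[of _ "[]"] exI[of _ x] exI[of _ "Exists_list ys \<phi>"]) simp
qed

text \<open>The prefix \<open>zs\<close> binds everything free in \<open>\<psi>\<close> besides
  \<open>x\<close>, and the only terms put for \<open>x\<close> are closed or have just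
  \<open>x\<close>, again under a quantifier. This licenses weakening by all of
  \<open>IE1 L\<close>.\<close>

lemma IE1_closed: "A \<in> IE1 L \<Longrightarrow> fvars A = {}"
proof -
  assume "A \<in> IE1 L"
  then obtain zs x \<psi> where A: "A = induction_fm L zs x \<psi>" "set zs = fvars \<psi> - {x}"
    unfolding IE1_def by blast
  have "fvars (inst \<psi> x t) \<subseteq> (fvars \<psi> - {x}) \<union> tvars t" for t
    by (auto simp: fvars_inst split: if_splits)
  from this[of "Zero L"] this[of "Succ L (Var x)"] show ?thesis
    unfolding A(1) induction_fm_def by (auto simp: A(2) Zero_def Succ_def)
qed

text \<open>Sentences cannot violate an eigenvariable condition, so they may join every context of a
  derivation without renaming.\<close>

lemma derivable_weaken_closed:
  "derivable L \<Gamma> \<phi> \<Longrightarrow> \<forall>\<delta>\<in>\<Delta>. fvars \<delta> = {} \<Longrightarrow> derivable L (\<Gamma> \<union> \<Delta>) \<phi>"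
proof (induction rule: derivable.induct)
  case (Assm \<phi> \<Gamma>)
  then show ?case by (auto intro: derivable.Assm)
next
  case (ImpI \<phi> \<Gamma> \<psi>)
  then show ?case by (auto intro: derivable.ImpI)
next
  case (ImpE \<Gamma> \<phi> \<psi>)
  show ?case by (rule derivable.ImpE) (rule ImpE.IH[OF ImpE.prems])+
next
  case (Raa \<phi> \<Gamma>)
  show ?case by (rule derivable.Raa[OF Raa.hyps(1)]) (use Raa.IH Raa.prems in simp)
next
  case (AllI x \<phi> y \<Gamma>)
  show ?case
    by (rule derivable.AllI[OF AllI.hyps(1-3)]) (use AllI.hyps(4) AllI.IH AllI.prems in auto)
next
  case (AllE \<Gamma> x \<phi> t)
  show ?case by (rule derivable.AllE[OF AllE.IH[OF AllE.prems] AllE.hyps(2)])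
next
  case (EqI t \<sigma> \<Gamma>)
  show ?case by (rule derivable.EqI[OF EqI.hyps])
next
  case (EqE \<phi> t x u \<Gamma>)
  show ?case by (rule derivable.EqE[OF EqE.hyps(1-3) EqE.IH(1)[OF EqE.prems] EqE.IH(2)[OF EqE.prems]])
qed

lemma teval_Succs:
  "teval M e (Succs L n t) = ((\<lambda>a. finterp M (succ_sym L) [a]) ^^ n) (teval M e t)"
  by (induction n) (auto simp: Succs_def Succ_def)

lemma sat_induction_fm:
  assumes "snd x = nat_sort L"
  shows "sat M e (induction_fm L [] x \<psi>) \<longleftrightarrow>
    (sat M (e(x := finterp M (zero_sym L) [])) \<psi> \<longrightarrow>
     (\<forall>a\<in>univ M (nat_sort L). sat M (e(x := a)) \<psi> \<longrightarrow>
        sat M (e(x := finterp M (succ_sym L) [a])) \<psi>) \<longrightarrow>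
     (\<forall>a\<in>univ M (nat_sort L). sat M (e(x := a)) \<psi>))"
  using assms by (simp add: induction_fm_def Forall_list_def sat_inst Zero_def Succ_def)

lemma is_formula_induction_fm:
  assumes "is_language L" "snd x = nat_sort L" "is_formula L \<psi>"
  shows "is_formula L (induction_fm L zs x \<psi>)"
proof -
  have "has_sort L (Zero L) (snd x)" "has_sort L (Succ L (Var x)) (snd x)"
    using assms(1,2) by (simp_all add: is_language_def Zero_def Succ_def)
  then show ?thesis using assms(3) by (simp add: induction_fm_def is_formula_inst)
qed

lemma is_formula_clause_set: "is_clause_set L S \<Longrightarrow> is_formula L S"
  by (auto simp: is_clause_set_def is_formula_Conj is_clause_def)

text \<open>Each round strips one more successor. If \<open>z\<close> is reached after
  \<open>n\<close> rounds, \<open>a\<close> is the \<open>n\<close>-th iterate of \<open>z\<close>,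
  which the next bound \<open>Suc n\<close> admits; otherwise a further predecessor remains.\<close>

lemma funpow_cases:
  assumes "\<And>a. a \<in> U \<Longrightarrow> a = z \<or> (\<exists>b\<in>U. a = s b)" "a \<in> U"
  shows "(\<exists>k<n. a = (s ^^ k) z) \<or> (\<exists>b\<in>U. a = (s ^^ n) b)"
proof (induction n)
  case 0
  show ?case using assms(2) by auto
next
  case (Suc n)
  then consider k where "k < n" "a = (s ^^ k) z" | b where "b \<in> U" "a = (s ^^ n) b" by blast
  then show ?case
  proof cases
    case 1
    then show ?thesis using less_SucI by blast
  next
    case 2
    consider "b = z" | c where "c \<in> U" "b = s c" using assms(1)[OF 2(1)] by blast
    then show ?thesis
    proof cases
      case 1
      then show ?thesis using 2 by blast
    next
      case (2 c)
      have "a = (s ^^ Suc n) c" using \<open>a = (s ^^ n) b\<close> 2(2) by (simp add: funpow_swap1)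
      then show ?thesis using 2(1) by blast
    qed
  qed
qed

theorem theorem2p10:
  fixes L :: "('s :: finite, 'f, 'p) language" and x :: "'s var"
    and R S :: "('s, 'f, 'p) fm"
  assumes "is_language L"
    and "infinite (UNIV :: 'u set)"
    and "is_clause_set_in L x R"
    and "clause_set_cycle TYPE('u) L x S"
    and "refuted_by TYPE('u) L x R S"
  shows "derivable L (IE1 L) (Forall x (Neg R))"
proof -
  have x: "snd x = nat_sort L" and R: "is_formula L R" "fvars R \<subseteq> {x}"
    using assms(3) is_formula_clause_set by (auto simp: is_clause_set_in_def)
  have S: "is_clause_set L S" "fvars S \<subseteq> {x}"
    and S_step: "entails TYPE('u) L (inst S x (Succ L (Var x))) S"
    and S_zero: "entails TYPE('u) L (inst S x (Zero L)) Bot"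
    using assms(4) by (auto simp: clause_set_cycle_def is_clause_set_in_def)
  obtain n where R_tail: "entails TYPE('u) L (inst R x (Succs L n (Var x))) S"
    and R_init: "\<And>k. k < n \<Longrightarrow> entails TYPE('u) L (inst R x (numeral_tm L k)) Bot"
    using assms(5) by (auto simp: refuted_by_def)
  obtain x0 ys \<phi> where x0: "snd x0 = snd x" "x0 \<notin> set ys"
    and \<phi>: "quantifier_free \<phi>" "is_formula L \<phi>" "fvars \<phi> \<subseteq> insert x0 (set ys)"
    and sat_\<phi>: "\<And>(M :: ('u, 's, 'f, 'p) fo_structure) e. is_assignment M e \<Longrightarrow>
      sat M e (Exists_list ys \<phi>) \<longleftrightarrow> \<not> sat M (e(x := e x0)) S"
    by (rule negated_clause_set[OF S]) blast
  \<comment> \<open>\<open>y\<close> must differ from \<open>x0\<close>, which its quantifier in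
    \<open>\<psi>2\<close> would otherwise capture.\<close>
  obtain y where y: "snd y = nat_sort L" "y \<notin> {x0}" by (rule fresh_var[of "{x0}"]) simp_all
  define \<psi>1 where "\<psi>1 = Exists_list ys \<phi>"
  define \<psi>2 :: "('s, 'f, 'p) fm" where "\<psi>2 = Exists_list [y] (Or (Eq (Var x0) (Zero L)) (Eq (Var x0) (Succ L (Var y))))"
  let ?I1 = "induction_fm L [] x0 \<psi>1" and ?I2 = "induction_fm L [] x0 \<psi>2"
  have f: "is_formula L \<psi>1" "is_formula L \<psi>2"
    using \<phi>(2) assms(1) x x0(1) y(1)
    by (auto simp: \<psi>1_def \<psi>2_def Zero_def Succ_def is_language_def)
  have I1: "?I1 \<in> IE1 L"
    unfolding \<psi>1_def by (rule IE1_I) (use \<phi> x x0(1) in auto)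
  have I2: "?I2 \<in> IE1 L"
    unfolding \<psi>2_def
    by (rule IE1_I) (use f(2) x x0(1) in \<open>auto simp: \<psi>2_def Zero_def Succ_def\<close>)
  have "derivable L {} (Imp ?I1 (Imp ?I2 (Forall x (Neg R))))"
  proof (rule completeness[OF assms(2)])
    show "is_formula L (Imp ?I1 (Imp ?I2 (Forall x (Neg R))))"
      using assms(1) x x0(1) f R(1) by (simp add: is_formula_induction_fm)
  next
    fix M :: "('u, 's, 'f, 'p) fo_structure" and e
    assume M: "is_structure L M" and e: "is_assignment M e"
    define U where "U = univ M (nat_sort L)"
    define z where "z = finterp M (zero_sym L) []"
    define s where "s a = finterp M (succ_sym L) [a]" for a
    then have s_eq: "s = (\<lambda>a. finterp M (succ_sym L) [a])" by auto
    have z_U: "z \<in> U" and s_U: "\<And>a. a \<in> U \<Longrightarrow> s a \<in> U"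
    proof -
      have *: "finterp M f as \<in> univ M (fcod L f)"
        if "f \<in> funs L" "list_all2 (\<lambda>a \<sigma>. a \<in> univ M \<sigma>) as (fdom L f)" for f as
        using M that by (simp add: is_structure_def)
      show "z \<in> U" using *[of "zero_sym L" "[]"] assms(1) by (simp add: is_language_def z_def U_def)
      show "s a \<in> U" if "a \<in> U" for a
        using *[of "succ_sym L" "[a]"] assms(1) that by (simp add: is_language_def s_def U_def)
    qed
    have upd: "is_assignment M (e(v := a))" if "snd v = nat_sort L" "a \<in> U" for v a
      using e that by (simp add: is_assignment_upd U_def)
    \<comment> \<open>\<open>sat_\<phi>\<close> evaluates \<open>S\<close> with \<open>x\<close> set
      to the value of \<open>x0\<close>. Only \<open>x\<close> can be free in \<open>S\<close>, so
      the change at \<open>x0\<close> itself is invisible.\<close>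
    have sat_\<psi>1: "sat M (e(x0 := a)) \<psi>1 \<longleftrightarrow> \<not> sat M (e(x := a)) S" if "a \<in> U" for a
    proof -
      have "sat M ((e(x0 := a))(x := a)) S \<longleftrightarrow> sat M (e(x := a)) S"
        by (rule sat_cong) (use S(2) in auto)
      then show ?thesis
        using sat_\<phi>[OF upd[of x0 a]] that x x0(1) by (simp add: \<psi>1_def)
    qed
    have sat_\<psi>2: "sat M (e(x0 := a)) \<psi>2 \<longleftrightarrow> a = z \<or> (\<exists>b\<in>U. a = s b)" for a
      using y z_U
      by (auto simp: \<psi>2_def Exists_list_def Zero_def Succ_def U_def z_def s_def)
    have "sat M e (Forall x (Neg R))" if "sat M e ?I1" "sat M e ?I2"
    proof -
      have no_S: "\<not> sat M (e(x := a)) S" if "a \<in> U" for a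
      proof -
        have "\<not> sat M (e(x := z)) S"
          using S_zero M e unfolding entails_def by (auto simp: sat_inst Zero_def z_def)
        \<comment> \<open>The contrapositive of \<open>S_step\<close>, read at
          \<open>a\<close>.\<close>
        moreover have "\<not> sat M (e(x := s a)) S" if "a \<in> U" "\<not> sat M (e(x := a)) S" for a
          using S_step M upd[OF x that(1)] that(2)
          unfolding entails_def by (fastforce simp: sat_inst Succ_def s_def)
        ultimately have "\<forall>a\<in>U. sat M (e(x0 := a)) \<psi>1"
          using \<open>sat M e ?I1\<close> z_U s_U x x0(1)
          by (simp add: sat_induction_fm sat_\<psi>1 flip: U_def z_def s_def)
        then show ?thesis using that sat_\<psi>1 by blast
      qed
      have cases: "a = z \<or> (\<exists>b\<in>U. a = s b)" if "a \<in> U" for a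
      proof -
        \<comment> \<open>Zero satisfies the left disjunct, and \<open>s a\<close> has
          \<open>a\<close> as its predecessor.\<close>
        have "\<forall>a\<in>U. sat M (e(x0 := a)) \<psi>2"
          using \<open>sat M e ?I2\<close> z_U s_U x x0(1)
          by (auto simp: sat_induction_fm sat_\<psi>2 simp flip: U_def z_def s_def)
        then show ?thesis using that sat_\<psi>2 by blast
      qed
      have "\<not> sat M (e(x := a)) R" if "a \<in> U" for a
      proof -
        have "(\<exists>k<n. a = (s ^^ k) z) \<or> (\<exists>b\<in>U. a = (s ^^ n) b)"
          by (rule funpow_cases[OF cases \<open>a \<in> U\<close>])
        then show ?thesis
        proof (elim disjE exE bexE conjE)
          fix k assume k: "k < n" "a = (s ^^ k) z"
          have "sat M e (inst R x (numeral_tm L k)) \<longleftrightarrow> sat M (e(x := a)) R"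
            using k(2) by (simp add: sat_inst numeral_tm_def teval_Succs Zero_def z_def s_eq)
          then show ?thesis
            using R_init[OF k(1), unfolded entails_def, rule_format, OF M e] by auto
        next
          \<comment> \<open>\<open>R_tail\<close> is read with \<open>x\<close> denoting
            \<open>b\<close>: truth of \<open>R\<close> at \<open>(s ^^ n) b\<close> would force
            \<open>S\<close> at \<open>b\<close>, against \<open>no_S\<close>.\<close>
          fix b assume b: "b \<in> U" "a = (s ^^ n) b"
          have "sat M (e(x := b)) (inst R x (Succs L n (Var x))) \<longleftrightarrow> sat M (e(x := a)) R"
            using b(2) by (simp add: sat_inst teval_Succs s_eq)
          then show ?thesis
            using R_tail[unfolded entails_def, rule_format, OF M upd[OF x b(1)]] no_S[OF b(1)] by blast
        qed
      qed
      then show ?thesis using x by (simp add: U_def)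
    qed
    then show "sat M e (Imp ?I1 (Imp ?I2 (Forall x (Neg R))))" by simp
  qed
  then have imp: "derivable L (IE1 L) (Imp ?I1 (Imp ?I2 (Forall x (Neg R))))"
    using derivable_weaken_closed[of L "{}" _ "IE1 L"] IE1_closed[of _ L] by simp
  have I: "derivable L (IE1 L) ?I1" "derivable L (IE1 L) ?I2"
    using I1 I2 f assms(1) x x0(1) by (simp_all add: Assm is_formula_induction_fm)
  show ?thesis by (rule ImpE[OF ImpE[OF imp I(1)] I(2)])
qed

end
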